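(* Let $\boldsymbol{X}=\boldsymbol{V}_h\times Q_h$, $\zeta=\sqrt{\lambda+2\mu/d}$, and let $H_{\boldsymbol{u}}:\boldsymbol{V}_h'\to\boldsymbol{V}_h$ and $H_p:Q_h'\to Q_h$ be symmetric positive definite operators. Let $$\mathcal{A}=\begin{pmatrix}A_{\boldsymbol{u}}&\alpha B^T\\-\alpha B&\tau A_p+\eta h^2L_p\end{pmatrix},\quad \mathcal{M}_U=\begin{pmatrix}H_{\boldsymbol{u}}^{-1}&\alpha B^T\\0&H_p^{-1}\end{pmatrix}^{-1},\quad \mathcal{M}_D=\begin{pmatrix}H_{\boldsymbol{u}}&0\\0&H_p\end{pmatrix}.$$ Suppose that there are positive constants $c_{1,\boldsymbol{u}},c_{2,\boldsymbol{u}},c_{1,p},c_{2,p}$ such that $$c_{1,\boldsymbol{u}}(H_{\boldsymbol{u}}\boldsymbol{u},\boldsymbol{u})\le(A_{\boldsymbol{u}}^{-1}\boldsymbol{u},\boldsymbol{u})\le c_{2,\boldsymbol{u}}(H_{\boldsymbol{u}}\boldsymbol{u},\boldsymbol{u})\quad\text{for all }\boldsymbol{u}\in\boldsymbol{V}_h',$$ $$c_{1,p}(H_pp,p)\le\Big(\big(\tau A_p+\eta h^2L_p+\tfrac{\alpha^2}{\zeta^2}M\big)^{-1}p,p\Big)\le c_{2,p}(H_pp,p)\quad\text{for all }p\in Q_h',$$ that $\|I-H_{\boldsymbol{u}}A_{\boldsymbol{u}}\|_{A_{\boldsymbol{u}}}\le\rho$ with $0\le\rho<1$, and that $\eta=\delta\frac{\alpha^2}{\zeta^2}$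 with $\delta>0$. Then there exist positive constants $\Sigma$ and $\Upsilon$, independent of discretization or physical parameters, such that, for any $\boldsymbol{0}\ne\boldsymbol{x}'\in\boldsymbol{X}'$, $$\Sigma\le\frac{(\mathcal{A}\mathcal{M}_U\boldsymbol{x}',\boldsymbol{x}')_{\mathcal{M}_D}}{(\boldsymbol{x}',\boldsymbol{x}')_{\mathcal{M}_D}},\qquad \frac{\|\mathcal{A}\mathcal{M}_U\boldsymbol{x}'\|_{\mathcal{M}_D}}{\|\boldsymbol{x}'\|_{\mathcal{M}_D}}\le\Upsilon.$$
   Context: Setting. $\Omega\subset\mathbb{R}^d$, $d\in\{2,3\}$, is a bounded open set with regular boundary. Physical parameters: Lamé coefficients $\lambda\ge 0$, $\mu>0$; Biot–Willis constant $\alpha>0$; hydraulic conductivity $K>0$. Discretization parameters: mesh size $h>0$, time step size $\tau>0$. $(\cdot,\cdot)$ and $\|\cdot\|$ are the $L^2(\Omega)$ inner product and norm (also used for the duality pairing between a finite-dimensional space and its dual), $\|\cdot\|_1$ is the $H^1(\Omega)$ norm, and $\varepsilon(\boldsymbol{u})=\frac12(\nabla\boldsymbol{u}+\nabla\boldsymbol{u}^t)$. Bilinear forms: $a(\boldsymbol{u},\boldsymbol{v})=2\mu\int_\Omega\varepsilon(\boldsymbol{u}):\varepsilon(\boldsymbol{v})+\lambda\int_\Omega\operatorname{div}\boldsymbol{u}\,\operatorname{div}\boldsymbol{v}$ and $a_p(p,q)=\int_\Omega K\nabla p\cdot\nabla q$. Finite-element spaces: $\boldsymbol{V}_h\subset\boldsymbol{H}^1_0(\Omega)=H_0^1(\Omega)^d$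 and $Q_h\subset H^1_0(\Omega)$ are the finite-element spaces for displacement and pressure given by the $\mathbb{P}_1$-$\mathbb{P}_1$ pair or the Mini element on a mesh of size $h$. The pair is taken to satisfy the weak inf-sup condition $$\sup_{0\ne\boldsymbol{v}\in\boldsymbol{V}_h}\frac{(\operatorname{div}\boldsymbol{v},q)}{\|\boldsymbol{v}\|_1}\ge\gamma_B^0\|q\|-\xi^0h\|\nabla q\|\qquad\text{for all }q\in Q_h,$$ with constants $\gamma_B^0>0$, $\xi^0\ge0$ that do not depend on $h$ ($\xi^0=0$ for the Mini element). Discrete operators: $A_{\boldsymbol{u}}:\boldsymbol{V}_h\to\boldsymbol{V}_h'$, $B:\boldsymbol{V}_h\to Q_h'$, $A_p,L_p,M:Q_h\to Q_h'$ are defined by $(A_{\boldsymbol{u}}\boldsymbol{u},\boldsymbol{v})=a(\boldsymbol{u},\boldsymbol{v})$, $(B\boldsymbol{u},q)=-(\operatorname{div}\boldsymbol{u},q)$, $(A_pp,q)=a_p(p,q)$, $(L_pp,q)=(\nabla p,\nabla q)$, $(Mp,q)=\int_\Omega pq$ (pressure mass operator); $B^T:Q_h\to\boldsymbol{V}_h'$ is the adjoint of $B$. Here $\mathcal{A}:\boldsymbol{X}\to\boldsymbol{X}'$ is the operator of the stabilized discrete Biot system with its second equation negated, and $\eta$ is the stabilization parameter. $\|\cdot\|_{A_{\boldsymbol{u}}}$ is the norm $\|\boldsymbol{v}\|_{A_{\boldsymbol{u}}}^2=a(\boldsymbol{v},\boldsymbol{v})$ on $\boldsymbol{V}_h$ and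 also the induced operator norm. For symmetric positive definite $\mathcal{N}:\boldsymbol{X}'\to\boldsymbol{X}$, $(\boldsymbol{x}',\boldsymbol{y}')_{\mathcal{N}}=\langle\boldsymbol{x}',\mathcal{N}\boldsymbol{y}'\rangle$ and $\|\boldsymbol{x}'\|_{\mathcal{N}}^2=(\boldsymbol{x}',\boldsymbol{x}')_{\mathcal{N}}$ for $\boldsymbol{x}',\boldsymbol{y}'\in\boldsymbol{X}'$. "Independent of discretization or physical parameters" means independent of $\lambda,\mu,K,\alpha,h,\tau$; the constants may depend on $d,\gamma_B^0,\xi^0,\delta,\rho,c_{1,\boldsymbol{u}},c_{2,\boldsymbol{u}},c_{1,p},c_{2,p}$. *)

theory Defs
  imports "HOL-Analysis.Analysis"
begin

section \<open>Domain and mesh\<close>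

text \<open>Regularity of the boundary is read as Lipschitz: near every boundary point, after choosing
  an axis \<open>e\<close>, the set is the part lying strictly above the graph of a Lipschitz function of the
  coordinates orthogonal to \<open>e\<close>.\<close>

definition lipschitz_boundary :: "'a::euclidean_space set \<Rightarrow> bool" where
  "lipschitz_boundary \<Omega> \<longleftrightarrow>
     (\<forall>x \<in> frontier \<Omega>. \<exists>e r L. \<exists>g :: 'a \<Rightarrow> real.
        norm e = 1 \<and> 0 < r \<and> L-lipschitz_on UNIV g \<and>
        (\<forall>y \<in> ball x r. y \<in> \<Omega> \<longleftrightarrow> g (y - (y \<bullet> e) *\<^sub>R e) < y \<bullet> e))"

text \<open>A mesh is given by its full-dimensional cells; \<^const>\<open>triangulation\<close> expresses that any two
  of them meet in a common face. For a polyhedral \<open>\<Omega>\<close> the cells may fill \<open>closure \<Omega>\<close>; only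
  inclusion is required, so that interior polyhedral approximations of a curved domain, for which
  the spaces below are still contained in \<open>H\<^sub>0\<^sup>1(\<Omega>)\<close>, are covered as well.\<close>

definition mesh_of :: "(real^'n) set \<Rightarrow> (real^'n) set set \<Rightarrow> bool" where
  "mesh_of \<Omega> \<T> \<longleftrightarrow>
     triangulation \<T> \<and> \<T> \<noteq> {} \<and> (\<forall>T \<in> \<T>. int CARD('n) simplex T) \<and> \<Union>\<T> \<subseteq> closure \<Omega>"

definition mesh_size :: "(real^'n) set set \<Rightarrow> real" where
  "mesh_size \<T> = Max (diameter ` \<T>)"


section \<open>Finite element spaces\<close>

text \<open>Finite element functions are continuous and are extended by zero to the whole space; they
  are therefore elements of the type of bounded continuous functions, whose vector space structure
  is used throughout.\<close>

type_synonym 'n sfield = "(real, 'n) vec \<Rightarrow>\<^sub>C real"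
type_synonym 'n vfield = "(real, 'n) vec \<Rightarrow>\<^sub>C (real, 'n) vec"

definition P1_functions :: "(real^'n) set set \<Rightarrow> (real^'n \<Rightarrow> real) set" where
  "P1_functions \<T> = {q. continuous_on UNIV q \<and>
     (\<forall>T \<in> \<T>. \<exists>a b. \<forall>x \<in> T. q x = a \<bullet> x + b) \<and>
     (\<forall>x. x \<notin> interior (\<Union>\<T>) \<longrightarrow> q x = 0)}"

definition barycentric :: "(real^'n) set \<Rightarrow> real^'n \<Rightarrow> real^'n \<Rightarrow> real" where
  "barycentric C x = (THE l. (\<forall>v. v \<notin> C \<longrightarrow> l v = 0) \<and> sum l C = 1 \<and> (\<Sum>v\<in>C. l v *\<^sub>R v) = x)"

text \<open>The bubble of a simplex is the product of the barycentric coordinates with respect to all of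
  its vertices (cubic for triangles, quartic for tetrahedra).\<close>

definition bubble :: "(real^'n) set \<Rightarrow> real^'n \<Rightarrow> real" where
  "bubble T x =
     (if x \<in> T then let C = {v. v extreme_point_of T} in \<Prod>v\<in>C. barycentric C x v else 0)"

definition MINI_functions :: "(real^'n) set set \<Rightarrow> (real^'n \<Rightarrow> real) set" where
  "MINI_functions \<T> = {w. \<exists>q \<in> P1_functions \<T>. \<exists>c. \<forall>x. w x = q x + (\<Sum>T\<in>\<T>. c T * bubble T x)}"

definition P1_scalar :: "(real^'n) set set \<Rightarrow> 'n sfield set" where
  "P1_scalar \<T> = {q. apply_bcontfun q \<in> P1_functions \<T>}"

definition P1_vector :: "(real^'n) set set \<Rightarrow> 'n vfield set" where
  "P1_vector \<T> = {v. \<forall>i. (\<lambda>x. apply_bcontfun v x $ i) \<in> P1_functions \<T>}"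

definition MINI_vector :: "(real^'n) set set \<Rightarrow> 'n vfield set" where
  "MINI_vector \<T> = {v. \<forall>i. (\<lambda>x. apply_bcontfun v x $ i) \<in> MINI_functions \<T>}"


section \<open>Differential operators and bilinear forms\<close>

text \<open>Finite element functions are Lipschitz and piecewise polynomial, so the classical derivative
  exists off the null set of cell boundaries and represents the weak one. Values of
  \<^const>\<open>frechet_derivative\<close> on that null set are irrelevant for the integrals.\<close>

definition grad :: "(real^'n \<Rightarrow> real) \<Rightarrow> real^'n \<Rightarrow> real^'n" where
  "grad q x = (\<chi> i. frechet_derivative q (at x) (axis i 1))"

definition grad_vec :: "(real^'n \<Rightarrow> real^'n) \<Rightarrow> real^'n \<Rightarrow> real^'n^'n" where
  "grad_vec v x = jacobian v (at x)"

definition strain :: "(real^'n \<Rightarrow> real^'n) \<Rightarrow> real^'n \<Rightarrow> real^'n^'n" where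
  "strain v x = (1/2) *\<^sub>R (grad_vec v x + transpose (grad_vec v x))"

definition divergence :: "(real^'n \<Rightarrow> real^'n) \<Rightarrow> real^'n \<Rightarrow> real" where
  "divergence v x = trace (grad_vec v x)"

text \<open>On matrices the inner product is the Frobenius product.\<close>

definition L2_inner ::
  "(real^'n) set \<Rightarrow> (real^'n \<Rightarrow> 'b::real_inner) \<Rightarrow> (real^'n \<Rightarrow> 'b) \<Rightarrow> real" where
  "L2_inner \<Omega> f g = (LINT x:\<Omega>|lebesgue. f x \<bullet> g x)"

definition L2_norm :: "(real^'n) set \<Rightarrow> (real^'n \<Rightarrow> 'b::real_inner) \<Rightarrow> real" where
  "L2_norm \<Omega> f = sqrt (L2_inner \<Omega> f f)"

definition H1_norm :: "(real^'n) set \<Rightarrow> (real^'n \<Rightarrow> real^'n) \<Rightarrow> real" where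
  "H1_norm \<Omega> v = sqrt ((L2_norm \<Omega> v)\<^sup>2 + (L2_norm \<Omega> (grad_vec v))\<^sup>2)"

definition form_a ::
  "(real^'n) set \<Rightarrow> real \<Rightarrow> real \<Rightarrow> (real^'n \<Rightarrow> real^'n) \<Rightarrow> (real^'n \<Rightarrow> real^'n) \<Rightarrow> real" where
  "form_a \<Omega> lam \<mu> u v =
     2 * \<mu> * L2_inner \<Omega> (strain u) (strain v) + lam * L2_inner \<Omega> (divergence u) (divergence v)"

definition form_ap ::
  "(real^'n) set \<Rightarrow> real \<Rightarrow> (real^'n \<Rightarrow> real) \<Rightarrow> (real^'n \<Rightarrow> real) \<Rightarrow> real" where
  "form_ap \<Omega> K p q = L2_inner \<Omega> (\<lambda>x. K *\<^sub>R grad p x) (grad q)"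

text \<open>The supremum is taken in the extended reals, so no boundedness condition is involved.\<close>

definition weak_inf_sup ::
  "(real^'n) set \<Rightarrow> real \<Rightarrow> 'n vfield set \<Rightarrow> 'n sfield set \<Rightarrow> real \<Rightarrow> real \<Rightarrow> bool"
where
  "weak_inf_sup \<Omega> h V Q \<gamma> \<xi> \<longleftrightarrow>
     (\<forall>q \<in> Q. (SUP v \<in> V - {0}. ereal (L2_inner \<Omega> (divergence (apply_bcontfun v)) q
                                       / H1_norm \<Omega> (apply_bcontfun v)))
                \<ge> ereal (\<gamma> * L2_norm \<Omega> q - \<xi> * h * L2_norm \<Omega> (grad q)))"


section \<open>Dual spaces and operators\<close>

text \<open>The dual of a subspace \<open>V\<close> consists of the linear functionals on \<open>V\<close>; they are set to zero
  outside \<open>V\<close>, so that equality of functionals is equality on \<open>V\<close>. All spaces are finite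
  dimensional, so continuity is automatic. The pairing of \<open>f\<close> and \<open>v\<close> is \<open>f v\<close>.\<close>

definition dual_space :: "'a::real_vector set \<Rightarrow> ('a \<Rightarrow> real) set" where
  "dual_space V = {f. (\<forall>u\<in>V. \<forall>v\<in>V. f (u + v) = f u + f v) \<and>
                      (\<forall>c. \<forall>v\<in>V. f (c *\<^sub>R v) = c * f v) \<and>
                      (\<forall>v. v \<notin> V \<longrightarrow> f v = 0)}"

definition form_operator :: "'b set \<Rightarrow> ('a \<Rightarrow> 'b \<Rightarrow> real) \<Rightarrow> 'a \<Rightarrow> 'b \<Rightarrow> real" where
  "form_operator W b u = (\<lambda>w. if w \<in> W then b u w else 0)"

definition spd_operator :: "'a::real_vector set \<Rightarrow> (('a \<Rightarrow> real) \<Rightarrow> 'a) \<Rightarrow> bool" where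
  "spd_operator V H \<longleftrightarrow>
     (\<forall>f \<in> dual_space V. H f \<in> V) \<and>
     (\<forall>f \<in> dual_space V. \<forall>g \<in> dual_space V. H (\<lambda>v. f v + g v) = H f + H g) \<and>
     (\<forall>c. \<forall>f \<in> dual_space V. H (\<lambda>v. c * f v) = c *\<^sub>R H f) \<and>
     (\<forall>f \<in> dual_space V. \<forall>g \<in> dual_space V. f (H g) = g (H f)) \<and>
     (\<forall>f \<in> dual_space V. f \<noteq> (\<lambda>_. 0) \<longrightarrow> 0 < f (H f))"

definition op_A ::
  "(real^'n) set \<Rightarrow> 'n vfield set \<Rightarrow> real \<Rightarrow> real \<Rightarrow>
   'n vfield \<Rightarrow> 'n vfield \<Rightarrow> real" where
  "op_A \<Omega> V lam \<mu> = form_operator V (\<lambda>u v. form_a \<Omega> lam \<mu> (apply_bcontfun u) (apply_bcontfun v))"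

definition op_B ::
  "(real^'n) set \<Rightarrow> 'n sfield set \<Rightarrow>
   'n vfield \<Rightarrow> 'n sfield \<Rightarrow> real" where
  "op_B \<Omega> Q = form_operator Q (\<lambda>u q. - L2_inner \<Omega> (divergence (apply_bcontfun u)) (apply_bcontfun q))"

definition op_BT ::
  "(real^'n) set \<Rightarrow> 'n vfield set \<Rightarrow> 'n sfield set \<Rightarrow>
   'n sfield \<Rightarrow> 'n vfield \<Rightarrow> real" where
  "op_BT \<Omega> V Q = form_operator V (\<lambda>p v. op_B \<Omega> Q v p)"

definition op_Ap ::
  "(real^'n) set \<Rightarrow> 'n sfield set \<Rightarrow> real \<Rightarrow>
   'n sfield \<Rightarrow> 'n sfield \<Rightarrow> real" where
  "op_Ap \<Omega> Q K = form_operator Q (\<lambda>p q. form_ap \<Omega> K (apply_bcontfun p) (apply_bcontfun q))"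

definition op_Lp ::
  "(real^'n) set \<Rightarrow> 'n sfield set \<Rightarrow>
   'n sfield \<Rightarrow> 'n sfield \<Rightarrow> real" where
  "op_Lp \<Omega> Q = form_operator Q (\<lambda>p q. L2_inner \<Omega> (grad (apply_bcontfun p)) (grad (apply_bcontfun q)))"

definition op_M ::
  "(real^'n) set \<Rightarrow> 'n sfield set \<Rightarrow>
   'n sfield \<Rightarrow> 'n sfield \<Rightarrow> real" where
  "op_M \<Omega> Q = form_operator Q (\<lambda>p q. L2_inner \<Omega> (apply_bcontfun p) (apply_bcontfun q))"

text \<open>Norm on \<open>V\<close> induced by an operator \<open>A\<close> from \<open>V\<close> to its dual, and the corresponding operator
  norm. As in \<^const>\<open>onorm\<close>, the vector zero contributes the quotient \<open>0 / 0 = 0\<close>.\<close>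

definition energy_norm :: "('a \<Rightarrow> 'a \<Rightarrow> real) \<Rightarrow> 'a \<Rightarrow> real" where
  "energy_norm A v = sqrt (A v v)"

definition energy_onorm :: "'a set \<Rightarrow> ('a \<Rightarrow> 'a \<Rightarrow> real) \<Rightarrow> ('a \<Rightarrow> 'a) \<Rightarrow> ereal" where
  "energy_onorm V A F = (SUP v \<in> V. ereal (energy_norm A (F v) / energy_norm A v))"


section \<open>Block operators\<close>

text \<open>The dual of \<open>V \<times> Q\<close> is represented by pairs of functionals.\<close>

definition dual_pairing :: "('a \<Rightarrow> real) \<times> ('b \<Rightarrow> real) \<Rightarrow> 'a \<times> 'b \<Rightarrow> real" where
  "dual_pairing x' y = fst x' (fst y) + snd x' (snd y)"

definition inner_wrt ::
  "(('a \<Rightarrow> real) \<times> ('b \<Rightarrow> real) \<Rightarrow> 'a \<times> 'b) \<Rightarrow>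
   ('a \<Rightarrow> real) \<times> ('b \<Rightarrow> real) \<Rightarrow> ('a \<Rightarrow> real) \<times> ('b \<Rightarrow> real) \<Rightarrow> real" where
  "inner_wrt N x' y' = dual_pairing x' (N y')"

definition norm_wrt ::
  "(('a \<Rightarrow> real) \<times> ('b \<Rightarrow> real) \<Rightarrow> 'a \<times> 'b) \<Rightarrow> ('a \<Rightarrow> real) \<times> ('b \<Rightarrow> real) \<Rightarrow> real" where
  "norm_wrt N x' = sqrt (inner_wrt N x' x')"

definition biot_operator ::
  "(real^'n) set \<Rightarrow> 'n vfield set \<Rightarrow> 'n sfield set \<Rightarrow>
   real \<Rightarrow> real \<Rightarrow> real \<Rightarrow> real \<Rightarrow> real \<Rightarrow> real \<Rightarrow> real \<Rightarrow>
   'n vfield \<times> 'n sfield \<Rightarrow>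
   ('n vfield \<Rightarrow> real) \<times> ('n sfield \<Rightarrow> real)" where
  "biot_operator \<Omega> V Q lam \<mu> \<alpha> K \<tau> h \<eta> = (\<lambda>(u, p).
     (\<lambda>v. op_A \<Omega> V lam \<mu> u v + \<alpha> * op_BT \<Omega> V Q p v,
      \<lambda>q. - \<alpha> * op_B \<Omega> Q u q + (\<tau> * op_Ap \<Omega> Q K p q + \<eta> * h\<^sup>2 * op_Lp \<Omega> Q p q)))"

definition precond_D ::
  "(('a \<Rightarrow> real) \<Rightarrow> 'a) \<Rightarrow> (('b \<Rightarrow> real) \<Rightarrow> 'b) \<Rightarrow> ('a \<Rightarrow> real) \<times> ('b \<Rightarrow> real) \<Rightarrow> 'a \<times> 'b" where
  "precond_D Hu Hp = (\<lambda>(f, g). (Hu f, Hp g))"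

definition precond_U ::
  "(real^'n) set \<Rightarrow> 'n vfield set \<Rightarrow> 'n sfield set \<Rightarrow> real \<Rightarrow>
   (('n vfield \<Rightarrow> real) \<Rightarrow> 'n vfield) \<Rightarrow>
   (('n sfield \<Rightarrow> real) \<Rightarrow> 'n sfield) \<Rightarrow>
   ('n vfield \<Rightarrow> real) \<times> ('n sfield \<Rightarrow> real) \<Rightarrow>
   'n vfield \<times> 'n sfield" where
  "precond_U \<Omega> V Q \<alpha> Hu Hp = inv_into (V \<times> Q) (\<lambda>(u, p).
     (\<lambda>v. inv_into (dual_space V) Hu u v + \<alpha> * op_BT \<Omega> V Q p v,
      inv_into (dual_space Q) Hp p))"

end

theory Submission
  imports Defs
begin

text \<open>
  In finite dimension every functional has a Riesz representer, so the preconditioner \<open>H\<^sub>u\<close> becomes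
  \<open>T = H\<^sub>u A\<^sub>u\<close>, which is self-adjoint in the energy inner product \<open>a\<close>, and \<open>k y z = a y (T z)\<close> is again
  an inner product; similarly for \<open>H\<^sub>p\<close> with the form \<open>s\<close> of \<open>\<tau> A\<^sub>p + \<eta> h\<^sup>2 L\<^sub>p + (\<alpha>\<^sup>2/\<zeta>\<^sup>2) M\<close>. The contraction bound makes
  \<open>k\<close> and \<open>a\<close> equivalent, with \<open>k \<le> 2 a\<close>. Writing \<open>x' = (A\<^sub>u \<phi>, S \<psi>)\<close>, \<open>p = H\<^sub>p S \<psi>\<close>,
  \<open>A\<^sub>u r = \<alpha> B\<^sup>T p\<close> and \<open>u = T (\<phi> - r)\<close>, the preconditioned vector is \<open>(u, p)\<close>, and the
  numerator of the first quotient is \<open>a u u + k u r + k r r + c p p\<close>, where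
  \<open>c\<close> belongs to \<open>\<tau> A\<^sub>p + \<eta> h\<^sup>2 L\<^sub>p\<close>. Since \<open>(k u r)\<^sup>2 \<le> 2 (a u u) (k r r)\<close>, the mixed term is absorbed, and the
  weak inf-sup condition bounds the missing \<open>L\<^sup>2\<close> part of \<open>s p p\<close> by \<open>a r r\<close> and the stabilization.
  All constants depend only on \<open>d\<close>, \<open>\<gamma>\<close>, \<open>\<xi>\<close>, \<open>\<delta>\<close>, \<open>\<rho>\<close> and the spectral constants because
  \<open>\<zeta>\<^sup>2 \<parallel>div v\<parallel>\<^sup>2 \<le> a v v \<le> d \<zeta>\<^sup>2 \<parallel>\<nabla>v\<parallel>\<^sup>2\<close>.
\<close>

section \<open>Symmetric bilinear forms\<close>

text \<open>Absorbing the mixed term is the critical point: from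
  \<open>(k u r)^2 <= C * a u u * k r r\<close> it needs \<open>C < 4\<close>. Spectral equivalence
  of the displacement preconditioner with the inverse of the elasticity operator gives
  \<open>C = 1 / c1u\<close>, which may be large; the contraction gives
  \<open>C = 1 + \<rho> < 2\<close>. The number \<open>a r r\<close> is the energy of
  \<open>p\<close> under the Schur complement, i.e. under \<open>\<alpha>^2\<close> times B composed
  with the inverse elasticity operator and the adjoint of B. The weak inf-sup condition says that it
  dominates the weighted mass of \<open>p\<close> up to a defect of order
  \<open>(\<alpha> / \<zeta>)^2 * h^2\<close> times the squared gradient norm. The scaling of
  \<open>\<eta>\<close> makes this defect a multiple \<open>\<xi>^2 / \<delta>\<close> of the
  stabilization, whatever the physical parameters. Korn's constant never enters: \<open>a\<close> is
  bounded below only by the divergence and above by the full gradient. Definiteness of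
  \<open>a\<close> is needed only qualitatively, for the existence of representers; it is proved on
  the given mesh by following lines through the cells.\<close>

lemma discriminant_le:
  fixes A B C :: real
  assumes quad: "\<And>t. 0 \<le> A + 2 * t * B + t\<^sup>2 * C" and "0 \<le> C"
  shows "B\<^sup>2 \<le> A * C"
proof (cases "C = 0")
  case False
  then show ?thesis
    using quad[of "- B / C"] assms(2) by (simp add: power2_eq_square field_simps)
next
  case True
  have "B = 0"
  proof (rule ccontr)
    assume nz: "B \<noteq> 0"
    have "0 \<le> A + 2 * (- (A + 1) / (2 * B)) * B"
      using quad[of "- (A + 1) / (2 * B)"] True by simp
    also have "\<dots> = - 1" using nz by (simp add: field_simps)
    finally show False by simp
  qed
  then show ?thesis using True by simp
qed

text \<open>Membership in \<open>dual_space V\<close> packages linearity in the second argument and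
  vanishing off \<open>V\<close>; symmetry transfers linearity to the first. The semidefinite layer
  serves the form \<open>c\<close>, which enters only through nonnegativity and
  Cauchy-Schwarz.\<close>

locale psd_form =
  fixes V :: "'a::real_vector set" and a :: "'a \<Rightarrow> 'a \<Rightarrow> real"
  assumes subspace: "subspace V"
    and dual: "u \<in> V \<Longrightarrow> a u \<in> dual_space V"
    and sym: "u \<in> V \<Longrightarrow> v \<in> V \<Longrightarrow> a u v = a v u"
    and nonneg: "u \<in> V \<Longrightarrow> 0 \<le> a u u"
begin

lemma mem [simp, intro]:
  "0 \<in> V" "u \<in> V \<Longrightarrow> v \<in> V \<Longrightarrow> u + v \<in> V" "u \<in> V \<Longrightarrow> v \<in> V \<Longrightarrow> u - v \<in> V"
  "u \<in> V \<Longrightarrow> c *\<^sub>R u \<in> V"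
  using subspace by (auto simp: subspace_0 subspace_add subspace_diff subspace_scale)

lemma add_right: "u \<in> V \<Longrightarrow> v \<in> V \<Longrightarrow> w \<in> V \<Longrightarrow> a u (v + w) = a u v + a u w"
  and scale_right: "u \<in> V \<Longrightarrow> v \<in> V \<Longrightarrow> a u (c *\<^sub>R v) = c * a u v"
  and outside: "u \<in> V \<Longrightarrow> v \<notin> V \<Longrightarrow> a u v = 0"
  using dual[of u] by (auto simp: dual_space_def)

lemma diff_right: "u \<in> V \<Longrightarrow> v \<in> V \<Longrightarrow> w \<in> V \<Longrightarrow> a u (v - w) = a u v - a u w"
  using add_right[of u "v - w" w] by simp

lemma add_left: "u \<in> V \<Longrightarrow> v \<in> V \<Longrightarrow> w \<in> V \<Longrightarrow> a (u + v) w = a u w + a v w"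
  and diff_left: "u \<in> V \<Longrightarrow> v \<in> V \<Longrightarrow> w \<in> V \<Longrightarrow> a (u - v) w = a u w - a v w"
  and scale_left: "u \<in> V \<Longrightarrow> v \<in> V \<Longrightarrow> a (c *\<^sub>R u) v = c * a u v"
  using sym[of "u + v" w] sym[of "u - v" w] sym[of "c *\<^sub>R u" v] sym[of u w] sym[of v w] sym[of u v]
  by (simp_all add: add_right diff_right scale_right)

lemma zero_left: "a 0 = (\<lambda>_. 0)"
proof
  fix w show "a 0 w = 0"
    using scale_left[of 0 w 0] outside[of 0 w] by (cases "w \<in> V") auto
qed

lemma cauchy_schwarz_sq:
  assumes "u \<in> V" "v \<in> V"
  shows "(a u v)\<^sup>2 \<le> a u u * a v v"
proof (rule discriminant_le)
  fix t
  have "a (u + t *\<^sub>R v) (u + t *\<^sub>R v) = a u u + 2 * t * a u v + t\<^sup>2 * a v v"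
    using assms sym[of v u]
    by (simp add: add_left add_right scale_left scale_right power2_eq_square algebra_simps)
  then show "0 \<le> a u u + 2 * t * a u v + t\<^sup>2 * a v v"
    using nonneg[of "u + t *\<^sub>R v"] assms by simp
qed (rule nonneg[OF assms(2)])

lemma cauchy_schwarz:
  assumes "u \<in> V" "v \<in> V"
  shows "\<bar>a u v\<bar> \<le> sqrt (a u u) * sqrt (a v v)"
  using cauchy_schwarz_sq[OF assms] by (metis abs_le_square_iff real_sqrt_abs real_sqrt_le_iff real_sqrt_mult)

lemma sum_sq_le:
  assumes "u \<in> V" "v \<in> V"
  shows "a (u + v) (u + v) \<le> 2 * a u u + 2 * a v v"
proof -
  have "0 \<le> a (u - v) (u - v)" using assms nonneg by blast
  then show ?thesis
    using assms sym[of v u] by (simp add: add_left add_right diff_left diff_right)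
qed

end

section \<open>Riesz representation in finite dimension\<close>

locale spd_form = psd_form +
  assumes definite: "u \<in> V \<Longrightarrow> a u u = 0 \<Longrightarrow> u = 0"
    and finite_dim: "\<exists>B. finite B \<and> span B = V"
begin

lemma eqI:
  assumes "u \<in> V" "v \<in> V" "\<And>w. w \<in> V \<Longrightarrow> a u w = a v w"
  shows "u = v"
  using assms definite[of "u - v"] by (simp add: diff_left)

lemma inj_on: "inj_on a V"
  using eqI by (auto intro!: inj_onI)

lemma inv_into_apply: "u \<in> V \<Longrightarrow> inv_into V a (a u) = u"
  by (rule inv_into_f_f[OF inj_on])

text \<open>Gram-Schmidt by induction on the generators: the new generator \<open>b\<close> is made
  orthogonal to the old span, and the old representer is corrected by a multiple of the orthogonal
  part \<open>e\<close>.\<close>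

lemma riesz_span:
  assumes "finite B" "B \<subseteq> V"
    and "\<And>u v. u \<in> V \<Longrightarrow> v \<in> V \<Longrightarrow> f (u + v) = f u + (f v :: real)"
    and "\<And>c v. v \<in> V \<Longrightarrow> f (c *\<^sub>R v) = c * f v"
  shows "\<exists>u \<in> span B. \<forall>v \<in> span B. f v = a u v"
  using assms
proof (induction B arbitrary: f rule: finite_induct)
  case empty
  then show ?case using scale_right[of 0 0 0] empty(3)[of 0 0] by simp
next
  case (insert b B)
  have sV: "span B \<subseteq> V" "span (insert b B) \<subseteq> V"
    using insert.prems(1) span_minimal[OF _ subspace] by auto
  have bV: "b \<in> V" using insert.prems by auto
  obtain u0 where u0: "u0 \<in> span B" "\<And>v. v \<in> span B \<Longrightarrow> f v = a u0 v"
    using insert.IH[of f] insert.prems by auto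
  \<comment> \<open>The induction hypothesis for the functional \<open>a b\<close> yields the
    orthogonal projection of \<open>b\<close> onto \<open>span B\<close>.\<close>
  obtain b0 where b0: "b0 \<in> span B" "\<And>v. v \<in> span B \<Longrightarrow> a b v = a b0 v"
    using insert.IH[of "a b"] insert.prems bV by (auto simp: add_right scale_right)
  define e where "e = b - b0"
  have mV: "u0 \<in> V" "b0 \<in> V" "e \<in> V" using u0 b0 sV bV by (auto simp: e_def)
  have orth: "a e v = 0" if "v \<in> span B" for v
    using that b0 bV mV sV by (auto simp: e_def diff_left)
  have e_in: "e \<in> span (insert b B)"
    unfolding e_def using b0(1) span_mono[of B "insert b B"]
    by (intro span_diff) (auto intro: span_base)
  have decomp: "\<exists>t. \<exists>w \<in> span B. v = w + t *\<^sub>R e" if v_in: "v \<in> span (insert b B)" for v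
  proof -
    obtain t where t: "v - t *\<^sub>R b \<in> span B" using v_in unfolding span_insert by blast
    have "v = (v - t *\<^sub>R b + t *\<^sub>R b0) + t *\<^sub>R e" by (simp add: e_def algebra_simps)
    moreover have "v - t *\<^sub>R b + t *\<^sub>R b0 \<in> span B"
      using t b0(1) by (intro span_add span_scale)
    ultimately show ?thesis by blast
  qed
  \<comment> \<open>If \<open>b\<close> lies in \<open>span B\<close>, then \<open>e = 0\<close> and
    \<open>c\<close> is \<open>0 / 0 = 0\<close>; this is harmless because then
    \<open>f e = 0\<close>.\<close>
  define c where "c = f e / a e e"
  have ce: "c * a e e = f e"
  proof (cases "e = 0")
    case True
    then have "f e = 0" using insert.prems(3)[of e 0] mV by simp
    then show ?thesis by (simp add: c_def)
  next
    case False
    then have "a e e \<noteq> 0" using definite mV by blast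
    then show ?thesis by (simp add: c_def)
  qed
  show ?case
  proof (intro bexI ballI)
    show "u0 + c *\<^sub>R e \<in> span (insert b B)"
      using u0(1) e_in span_mono[of B "insert b B"] by (intro span_add span_scale) auto
    fix v assume "v \<in> span (insert b B)"
    then obtain t w where w: "w \<in> span B" and v: "v = w + t *\<^sub>R e" using decomp by blast
    have wV: "w \<in> V" using w sV by auto
    have "a u0 e = 0" using orth[OF u0(1)] sym mV by simp
    moreover have "a e w = 0" using orth w by blast
    ultimately have "a (u0 + c *\<^sub>R e) v = a u0 w + t * (c * a e e)"
      unfolding v using mV wV by (simp add: add_left add_right scale_left scale_right)
    also have "\<dots> = f v"
      unfolding ce v using u0(2)[OF w] insert.prems(2,3) mV wV by simp
    finally show "f v = a (u0 + c *\<^sub>R e) v" by simp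
  qed
qed

lemma riesz:
  assumes f: "f \<in> dual_space V"
  obtains u where "u \<in> V" "f = a u"
proof -
  obtain B where B: "finite B" "span B = V" using finite_dim by blast
  have BV: "B \<subseteq> V" using B span_superset by blast
  obtain u where u: "u \<in> V" "\<And>v. v \<in> V \<Longrightarrow> f v = a u v"
    using riesz_span[OF B(1) BV, of f] f B by (auto simp: dual_space_def)
  have "f v = a u v" for v
    using u f outside by (cases "v \<in> V") (auto simp: dual_space_def)
  then show ?thesis using u that by blast
qed

end

section \<open>Preconditioners as symmetric operators in the energy inner product\<close>

locale preconditioned_form = spd_form V a
  for V :: "'a::real_vector set" and a +
  fixes H :: "('a \<Rightarrow> real) \<Rightarrow> 'a"
  assumes spd: "spd_operator V H"
begin

definition T :: "'a \<Rightarrow> 'a" where "T u = H (a u)"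

text \<open>The inner product of the functionals \<open>a u\<close> and \<open>a v\<close> induced
  by \<open>H\<close>, moved to their representers. It is cut off outside \<open>V\<close> because
  members of \<open>dual_space V\<close> vanish there.\<close>

definition k :: "'a \<Rightarrow> 'a \<Rightarrow> real" where "k u v = (if v \<in> V then a u (T v) else 0)"

lemma T_mem [simp]: "u \<in> V \<Longrightarrow> T u \<in> V"
  using spd dual by (auto simp: spd_operator_def T_def)

lemma T_add: "u \<in> V \<Longrightarrow> v \<in> V \<Longrightarrow> T (u + v) = T u + T v"
proof -
  assume *: "u \<in> V" "v \<in> V"
  have "a (u + v) = (\<lambda>w. a u w + a v w)"
  proof
    fix w show "a (u + v) w = a u w + a v w"
      using * outside[of "u + v" w] outside[of u w] outside[of v w]
      by (cases "w \<in> V") (auto simp: add_left)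
  qed
  then show ?thesis using * spd dual by (simp add: spd_operator_def T_def)
qed

lemma T_scale: "u \<in> V \<Longrightarrow> T (c *\<^sub>R u) = c *\<^sub>R T u"
proof -
  assume *: "u \<in> V"
  have "a (c *\<^sub>R u) = (\<lambda>w. c * a u w)"
  proof
    fix w show "a (c *\<^sub>R u) w = c * a u w"
      using * outside[of "c *\<^sub>R u" w] outside[of u w] by (cases "w \<in> V") (auto simp: scale_left)
  qed
  then show ?thesis using * spd dual by (simp add: spd_operator_def T_def)
qed

lemma T_diff: "u \<in> V \<Longrightarrow> v \<in> V \<Longrightarrow> T (u - v) = T u - T v"
  using T_add[of "u - v" v] by simp

lemma k_eq: "v \<in> V \<Longrightarrow> k u v = a u (T v)"
  by (simp add: k_def)

lemma T_sym: "u \<in> V \<Longrightarrow> v \<in> V \<Longrightarrow> a u (T v) = a (T u) v"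
  using spd dual sym[of v "T u"] by (auto simp: spd_operator_def T_def)

lemma spd_k: "spd_form V k"
proof
  show "subspace V" by (rule subspace)
  show "k u \<in> dual_space V" if "u \<in> V" for u
    using that by (auto simp: dual_space_def k_def T_add T_scale add_right scale_right)
  show "k u v = k v u" if "u \<in> V" "v \<in> V" for u v
    using that T_sym[of u v] sym[of "T u" v] by (simp add: k_eq)
  have pos: "0 < k u u" if "u \<in> V" "u \<noteq> 0" for u
  proof -
    have "a u u \<noteq> 0" using that definite by blast
    then have "a u \<noteq> (\<lambda>_. 0)" by auto
    then show ?thesis using spd dual that by (simp add: k_eq T_def spd_operator_def)
  qed
  have "k 0 0 = 0" using scale_right[of 0 0 0] T_scale[of 0 0] by (simp add: k_eq)
  then show "0 \<le> k u u" if "u \<in> V" for u using pos[of u] that by (cases "u = 0") auto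
  show "u = 0" if "u \<in> V" "k u u = 0" for u using pos[of u] that by auto
  show "\<exists>B. finite B \<and> span B = V" by (rule finite_dim)
qed

sublocale kf: spd_form V k by (rule spd_k)

text \<open>Tested with \<open>v\<close>, the equation \<open>T z = w\<close> reads
  \<open>k z v = a w v\<close>; so \<open>z\<close> is the Riesz representer of \<open>a w\<close>
  with respect to \<open>k\<close>.\<close>

lemma T_surj:
  assumes "w \<in> V"
  obtains z where "z \<in> V" "T z = w"
proof -
  obtain z where z: "z \<in> V" "a w = k z" using kf.riesz[OF dual[OF assms]] .
  have "T z = w"
  proof (rule eqI)
    fix v assume v: "v \<in> V"
    show "a (T z) v = a w v" using z v T_sym[of z v] by (simp add: k_eq)
  qed (use z assms in auto)
  then show ?thesis using z that by blast
qed

lemma H_inj: "inj_on H (dual_space V)"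
proof (rule inj_onI)
  fix f g assume fg: "f \<in> dual_space V" "g \<in> dual_space V" "H f = H g"
  obtain u v where uv: "u \<in> V" "f = a u" "v \<in> V" "g = a v" using fg riesz by metis
  then have "T (u - v) = 0" using fg by (simp add: T_diff) (simp add: T_def)
  then have "k (u - v) (u - v) = 0"
    using uv scale_right[of "u - v" 0 0] by (simp add: k_eq)
  then show "f = g" using uv kf.definite[of "u - v"] by simp
qed

lemma inv_H: "z \<in> V \<Longrightarrow> inv_into (dual_space V) H (T z) = a z"
  unfolding T_def by (rule inv_into_f_f[OF H_inj dual])

end

text \<open>Cancels one factor after a Cauchy-Schwarz estimate has reproduced the quantity to be
  bounded on its right-hand side.\<close>

lemma le_of_sq_le_mult:
  fixes x y :: real
  assumes "0 \<le> x" "x\<^sup>2 \<le> y * x" "0 \<le> y"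
  shows "x \<le> y"
  using assms by (cases "x = 0") (auto simp: power2_eq_square)

section \<open>Comparison of \<open>a\<close>, \<open>k\<close> and the energy of
  \<open>T v\<close>\<close>

context preconditioned_form
begin

context
  fixes \<rho> :: real
  assumes rho: "0 \<le> \<rho>" "\<rho> < 1"
    and contraction: "\<And>v. v \<in> V \<Longrightarrow> a (v - T v) (v - T v) \<le> \<rho>\<^sup>2 * a v v"
begin

text \<open>The defect is \<open>a v (v - T v)\<close>, to which Cauchy-Schwarz and the contraction
  bound apply.\<close>

lemma defect_bound:
  assumes "v \<in> V"
  shows "\<bar>a v v - k v v\<bar> \<le> \<rho> * a v v"
proof -
  have "sqrt (a (v - T v) (v - T v)) \<le> \<rho> * sqrt (a v v)"
    using real_sqrt_le_mono[OF contraction[OF assms]] rho by (simp add: real_sqrt_mult)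
  then have "sqrt (a v v) * sqrt (a (v - T v) (v - T v)) \<le> sqrt (a v v) * (\<rho> * sqrt (a v v))"
    using nonneg[OF assms] by (intro mult_left_mono) auto
  also have "\<dots> = \<rho> * a v v" using nonneg[OF assms] by simp
  finally have "\<bar>a v (v - T v)\<bar> \<le> \<rho> * a v v"
    using cauchy_schwarz[of v "v - T v"] assms by simp
  then show ?thesis using assms by (simp add: diff_right k_eq)
qed

text \<open>The factor \<open>1 + \<rho>\<close> is rounded up to 2: this keeps the upper constant
  free of \<open>\<rho>\<close> and stays below the threshold 4 for absorbing the mixed
  term.\<close>

lemma k_le: "v \<in> V \<Longrightarrow> k v v \<le> 2 * a v v"
  using defect_bound[of v] nonneg[of v] rho mult_right_mono[of \<rho> 1 "a v v"] by auto

lemma k_ge: "v \<in> V \<Longrightarrow> (1 - \<rho>) * a v v \<le> k v v"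
  using defect_bound[of v] by (auto simp: algebra_simps)

text \<open>Cauchy-Schwarz for \<open>a\<close> in \<open>k v v = a v (T v)\<close>, with
  \<open>a v v\<close> replaced through \<open>k_ge\<close>. The bound is needed because
  \<open>u = T (\<phi> - r)\<close> is measured by \<open>a\<close>, but the data by
  \<open>k\<close>.\<close>

lemma k_le_image:
  assumes "v \<in> V"
  shows "(1 - \<rho>) * k v v \<le> a (T v) (T v)"
proof -
  have "(k v v)\<^sup>2 \<le> a v v * a (T v) (T v)"
    using cauchy_schwarz_sq[of v "T v"] assms by (simp add: k_eq)
  then have "((1 - \<rho>) * k v v) * k v v \<le> ((1 - \<rho>) * a v v) * a (T v) (T v)"
    using rho mult_left_mono[of "(k v v)\<^sup>2" "a v v * a (T v) (T v)" "1 - \<rho>"]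
    by (simp add: power2_eq_square mult.assoc)
  also have "\<dots> \<le> k v v * a (T v) (T v)"
    using k_ge[OF assms] nonneg[of "T v"] assms by (intro mult_right_mono) auto
  finally have *: "((1 - \<rho>) * k v v) * k v v \<le> a (T v) (T v) * k v v" by (simp add: mult.commute)
  show ?thesis
  proof (cases "k v v = 0")
    case True then show ?thesis using nonneg[of "T v"] assms by simp
  next
    case False
    then have "0 < k v v" using kf.nonneg[OF assms] by simp
    then show ?thesis using * by simp
  qed
qed

text \<open>Here Cauchy-Schwarz is used for \<open>k\<close>, since
  \<open>a (T v) (T v) = k (T v) v\<close>.\<close>

lemma image_le_k:
  assumes "v \<in> V"
  shows "a (T v) (T v) \<le> 2 * k v v"
proof (rule le_of_sq_le_mult)
  have "(a (T v) (T v))\<^sup>2 = (k (T v) v)\<^sup>2" using assms by (simp add: k_eq)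
  also have "\<dots> \<le> k (T v) (T v) * k v v" using kf.cauchy_schwarz_sq assms by simp
  also have "\<dots> \<le> 2 * a (T v) (T v) * k v v"
    using k_le[of "T v"] kf.nonneg[OF assms] assms by (intro mult_right_mono) auto
  finally show "(a (T v) (T v))\<^sup>2 \<le> 2 * k v v * a (T v) (T v)" by (simp add: mult_ac)
qed (use assms nonneg kf.nonneg in auto)

end

text \<open>The hypothesis is tested at \<open>g = a z\<close>: then \<open>H g = T z\<close>, and
  inverting \<open>a\<close> returns \<open>z\<close>, so the two pairings are \<open>k z z\<close>
  and \<open>a z z\<close>.\<close>

lemma spectral_bounds:
  assumes "\<forall>g \<in> dual_space V. c1 * g (H g) \<le> g (inv_into V a g) \<and> g (inv_into V a g) \<le> c2 * g (H g)"
    and z: "z \<in> V"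
  shows "c1 * k z z \<le> a z z" "a z z \<le> c2 * k z z"
  using bspec[OF assms(1) dual[OF z]] inv_into_apply[OF z] z by (simp_all add: k_eq T_def)

text \<open>Both estimates compare the functional \<open>a (T z)\<close> with \<open>a z\<close> by the Cauchy-Schwarz inequality.\<close>

lemma k_le_of_spectral_upper:
  assumes "\<And>z. z \<in> V \<Longrightarrow> a z z \<le> c2 * k z z" "z \<in> V" "0 < c2"
  shows "k z z \<le> c2 * a (T z) (T z)"
proof (rule le_of_sq_le_mult)
  have "(k z z)\<^sup>2 \<le> a z z * a (T z) (T z)"
    using cauchy_schwarz_sq[of z "T z"] assms by (simp add: k_eq)
  also have "\<dots> \<le> (c2 * k z z) * a (T z) (T z)"
    using assms nonneg[of "T z"] by (intro mult_right_mono) auto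
  finally show "(k z z)\<^sup>2 \<le> c2 * a (T z) (T z) * k z z" by (simp add: mult_ac)
qed (use assms nonneg kf.nonneg in auto)

lemma image_le_of_spectral_lower:
  assumes "\<And>z. z \<in> V \<Longrightarrow> c1 * k z z \<le> a z z" "z \<in> V" "0 < c1"
  shows "a (T z) (T z) \<le> k z z / c1"
proof (rule le_of_sq_le_mult)
  have "(a (T z) (T z))\<^sup>2 = (k (T z) z)\<^sup>2" using assms by (simp add: k_eq)
  also have "\<dots> \<le> k (T z) (T z) * k z z" using kf.cauchy_schwarz_sq assms by simp
  also have "\<dots> \<le> (a (T z) (T z) / c1) * k z z"
    using assms(1)[of "T z"] assms(2,3) kf.nonneg[OF assms(2)]
    by (intro mult_right_mono) (auto simp: field_simps)
  finally show "(a (T z) (T z))\<^sup>2 \<le> k z z / c1 * a (T z) (T z)" by (simp add: mult_ac)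
qed (use assms nonneg kf.nonneg in auto)

end

section \<open>Field of values of the preconditioned Biot operator\<close>

text \<open>Collects the coefficients of \<open>lower_bound\<close>:
  \<open>U.k \<phi> \<phi>\<close> costs \<open>2 / (1 - \<rho>)\<close> times \<open>a u u\<close>
  and 2 times \<open>U.k r r\<close>, and these are divided by the weights 1/4 and 1/3 that survive
  the absorption of the mixed term. The summands with \<open>c2\<close> come from
  \<open>P.k \<psi> \<psi>\<close>.\<close>

definition fov_const :: "real \<Rightarrow> real \<Rightarrow> real \<Rightarrow> real \<Rightarrow> real" where
  "fov_const \<rho> k1 k2 c2 = 8 / (1 - \<rho>) + 6 + 3 * c2 * k1 / (1 - \<rho>) + c2 * k2"

text \<open>The first factor bounds the image by \<open>a u u + s p p\<close>, the second bounds
  that sum by the data. It concerns squared norms, so its square root is the final constant.\<close>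

definition norm_const :: "real \<Rightarrow> real" where
  "norm_const c1 = (4 + 2 / c1) * (4 + 9 / c1)"

lemma fov_const_pos: "\<rho> < 1 \<Longrightarrow> 0 \<le> k1 \<Longrightarrow> 0 \<le> k2 \<Longrightarrow> 0 < c2 \<Longrightarrow> 0 < fov_const \<rho> k1 k2 c2"
  by (auto simp: fov_const_def intro!: add_nonneg_pos add_pos_nonneg)

lemma norm_const_pos: "0 < c1 \<Longrightarrow> 0 < norm_const c1"
  by (auto simp: norm_const_def intro!: mult_pos_pos add_pos_pos)

text \<open>Here \<open>b p\<close> stands for the functional \<open>\<alpha> B\<^sup>T p\<close>, \<open>c\<close> for \<open>\<tau> A\<^sub>p + \<eta> h\<^sup>2 L\<^sub>p\<close>, and \<open>s\<close>
  for \<open>c\<close> plus the weighted mass form. The representer of \<open>b p\<close> plays the role of \<open>r\<close> in \<open>inf_sup\<close>.\<close>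

locale biot_forms =
  U: preconditioned_form V a Hu + P: preconditioned_form Q s Hp + C: psd_form Q c
  for V :: "'a::real_vector set" and a Hu and Q :: "'b::real_vector set" and s Hp and c +
  fixes b :: "'b \<Rightarrow> 'a \<Rightarrow> real" and \<rho> k1 k2 c1 c2 :: real
  assumes b_dual: "p \<in> Q \<Longrightarrow> b p \<in> dual_space V"
    and b_dual': "u \<in> V \<Longrightarrow> (\<lambda>q. b q u) \<in> dual_space Q"
    and rho: "0 \<le> \<rho>" "\<rho> < 1"
    and const_pos: "0 \<le> k1" "0 \<le> k2" "0 < c1" "0 < c2"
    and contraction: "v \<in> V \<Longrightarrow> a (v - U.T v) (v - U.T v) \<le> \<rho>\<^sup>2 * a v v"
    and spectral_lower: "z \<in> Q \<Longrightarrow> c1 * P.k z z \<le> s z z"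
    and spectral_upper: "z \<in> Q \<Longrightarrow> s z z \<le> c2 * P.k z z"
    and b_bound: "p \<in> Q \<Longrightarrow> v \<in> V \<Longrightarrow> (b p v)\<^sup>2 \<le> a v v * s p p"
    and c_le: "p \<in> Q \<Longrightarrow> c p p \<le> s p p"
    and inf_sup: "p \<in> Q \<Longrightarrow> r \<in> V \<Longrightarrow> b p = a r \<Longrightarrow> s p p \<le> k1 * a r r + k2 * c p p"
begin

abbreviation (input) "bound_const \<equiv> fov_const \<rho> k1 k2 c2"

abbreviation (input) "upper_const \<equiv> norm_const c1"

lemma bound_const_pos: "0 < bound_const"
  using fov_const_pos rho const_pos by blast

context
  fixes \<phi> \<psi> r \<theta>
  assumes mem: "\<phi> \<in> V" "\<psi> \<in> Q" "r \<in> V" "\<theta> \<in> Q"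
    and r: "b (P.T \<psi>) = a r"
    and \<theta>: "\<And>q. q \<in> Q \<Longrightarrow> s \<theta> q = - b q (U.T (\<phi> - r)) + c (P.T \<psi>) q"
begin

abbreviation (input) "u \<equiv> U.T (\<phi> - r)"
abbreviation (input) "p \<equiv> P.T \<psi>"

lemma u_mem: "u \<in> V" and p_mem: "p \<in> Q"
  using mem by auto

text \<open>The coupling blocks cancel: pairing the second component with \<open>p\<close> gives
  \<open>- a r u\<close>, while splitting \<open>\<phi>\<close> as \<open>(\<phi> - r) + r\<close>
  turns \<open>U.k r \<phi>\<close> into \<open>a r u + U.k r r\<close>. What remains is the cross
  term of \<open>U.k u \<phi> = a u u + U.k u r\<close>.\<close>

lemma field_of_values_eq:
  "U.k (u + r) \<phi> + P.k \<theta> \<psi> = a u u + U.k u r + U.k r r + c p p"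
proof -
  have "P.k \<theta> \<psi> = - a r u + c p p"
    using \<theta>[OF p_mem] mem r by (simp add: P.k_eq)
  moreover have "a r u = U.k r \<phi> - U.k r r"
    using mem by (simp add: U.k_eq U.T_diff U.diff_right)
  moreover have "a u u = U.k u \<phi> - U.k u r"
    using mem by (simp add: U.k_eq U.T_diff U.diff_right)
  moreover have "U.k (u + r) \<phi> = U.k u \<phi> + U.k r \<phi>"
    using mem by (simp add: U.kf.add_left)
  ultimately show ?thesis by simp
qed

text \<open>The weights satisfy \<open>4 * 3/4 * 2/3 = 2\<close>, so the product is bounded by the
  square of the weighted sum; both are below 1, which leaves 1/4 and 1/3 for coercivity.\<close>

lemma mixed_term:
  "\<bar>U.k u r\<bar> \<le> 3/4 * a u u + 2/3 * U.k r r"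
proof -
  have "(U.k u r)\<^sup>2 \<le> U.k u u * U.k r r"
    using U.kf.cauchy_schwarz_sq mem by simp
  also have "\<dots> \<le> 2 * a u u * U.k r r"
    using U.k_le[OF rho contraction u_mem] U.kf.nonneg[OF mem(3)] by (intro mult_right_mono) auto
  also have "\<dots> \<le> (3/4 * a u u + 2/3 * U.k r r)\<^sup>2"
    using zero_le_power2[of "3/4 * a u u - 2/3 * U.k r r"]
    by (simp add: power2_eq_square algebra_simps)
  finally have "\<bar>U.k u r\<bar> \<le> \<bar>3/4 * a u u + 2/3 * U.k r r\<bar>"
    by (simp only: abs_le_square_iff)
  moreover have "0 \<le> 3/4 * a u u + 2/3 * U.k r r"
    using U.nonneg[OF u_mem] U.kf.nonneg[OF mem(3)] by linarith
  ultimately show ?thesis by linarith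
qed

text \<open>Splitting \<open>\<phi> = (\<phi> - r) + r\<close> reduces the displacement part to
  \<open>A\<close> and \<open>R\<close>; the pressure part passes from \<open>\<psi>\<close> to
  \<open>p\<close> by the upper spectral bound and then to \<open>R\<close> and \<open>G\<close> by
  \<open>inf_sup\<close>.\<close>

lemma lower_bound:
  "U.k \<phi> \<phi> + P.k \<psi> \<psi> \<le> bound_const * (U.k (u + r) \<phi> + P.k \<theta> \<psi>)"
proof -
  define A R G where "A = a u u" and "R = U.k r r" and "G = c p p"
  have nn: "0 \<le> A" "0 \<le> R" "0 \<le> G"
    using U.nonneg u_mem U.kf.nonneg mem C.nonneg p_mem by (auto simp: A_def R_def G_def)
  have X: "A / 4 + R / 3 + G \<le> U.k (u + r) \<phi> + P.k \<theta> \<psi>"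
    using mixed_term unfolding field_of_values_eq A_def R_def G_def by linarith
  have "U.k \<phi> \<phi> \<le> 2 * U.k (\<phi> - r) (\<phi> - r) + 2 * R"
    using U.kf.sum_sq_le[of "\<phi> - r" r] mem by (simp add: R_def)
  also have "U.k (\<phi> - r) (\<phi> - r) \<le> A / (1 - \<rho>)"
    using U.k_le_image[OF rho contraction, of "\<phi> - r"] mem rho by (simp add: A_def field_simps)
  finally have 1: "U.k \<phi> \<phi> \<le> 2 / (1 - \<rho>) * A + 2 * R" by simp
  have "a r r \<le> R / (1 - \<rho>)"
    using U.k_ge[OF rho contraction mem(3)] rho by (simp add: R_def field_simps)
  then have "k1 * a r r \<le> k1 * (R / (1 - \<rho>))"
    using const_pos by (intro mult_left_mono)
  then have "s p p \<le> k1 / (1 - \<rho>) * R + k2 * G"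
    using inf_sup[OF p_mem mem(3) r] by (simp add: G_def)
  then have "c2 * s p p \<le> c2 * (k1 / (1 - \<rho>) * R + k2 * G)"
    using const_pos by (intro mult_left_mono) auto
  then have 2: "P.k \<psi> \<psi> \<le> c2 * (k1 / (1 - \<rho>) * R + k2 * G)"
    by (rule order.trans[OF P.k_le_of_spectral_upper[OF spectral_upper mem(2) const_pos(4), simplified]])
  define x y z where "x = 1 / (1 - \<rho>)" and "y = c2 * k1 * x" and "z = c2 * k2"
  have pos: "0 \<le> x" "0 \<le> y" "0 \<le> z" using rho const_pos by (auto simp: x_def y_def z_def)
  have "U.k \<phi> \<phi> + P.k \<psi> \<psi> \<le> 2 * x * A + 2 * R + (y * R + z * G)"
    using 1 2 by (simp add: x_def y_def z_def algebra_simps)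
  \<comment> \<open>Each term on the left is one of the products on the right, for instance
    \<open>2 * x * A = 8 * x * (A / 4)\<close>; the other products are nonnegative.\<close>
  also have "\<dots> \<le> (8 * x + 6 + 3 * y + z) * (A / 4 + R / 3 + G)"
    using nn pos by (simp add: algebra_simps add_increasing2)
  also have "\<dots> = bound_const * (A / 4 + R / 3 + G)"
    by (simp add: fov_const_def x_def y_def z_def)
  also have "\<dots> \<le> bound_const * (U.k (u + r) \<phi> + P.k \<theta> \<psi>)"
    using X bound_const_pos by (intro mult_left_mono) auto
  finally show ?thesis .
qed

text \<open>Everything is bounded by \<open>A + S\<close>, and that by the data. For
  \<open>r\<close> this rests on \<open>a r r = b p r\<close>, for \<open>\<theta>\<close> on
  testing its defining equation with \<open>\<theta>\<close> itself.\<close>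

lemma upper_bound:
  "U.k (u + r) (u + r) + P.k \<theta> \<theta> \<le> upper_const * (U.k \<phi> \<phi> + P.k \<psi> \<psi>)"
proof -
  define A R S G where "A = a u u" and "R = a r r" and "S = s p p" and "G = s \<theta> \<theta>"
  define F L where "F = U.k \<phi> \<phi>" and "L = P.k \<psi> \<psi>"
  have nn: "0 \<le> A" "0 \<le> R" "0 \<le> S" "0 \<le> G" "0 \<le> F" "0 \<le> L"
    using U.nonneg u_mem U.kf.nonneg mem P.nonneg p_mem P.kf.nonneg
    by (auto simp: A_def R_def S_def G_def F_def L_def)
  have RS: "R \<le> S"
    using b_bound[OF p_mem mem(3)] nn unfolding r R_def S_def
    by - (rule le_of_sq_le_mult, simp_all add: mult.commute)
  have SL: "S \<le> L / c1"
    unfolding S_def L_def by (rule P.image_le_of_spectral_lower[OF spectral_lower mem(2) const_pos(3)])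
  have "A \<le> 2 * U.k (\<phi> - r) (\<phi> - r)"
    using U.image_le_k[OF rho contraction, of "\<phi> - r"] mem by (simp add: A_def)
  also have "\<dots> \<le> 4 * F + 4 * U.k r r"
    using U.kf.sum_sq_le[of \<phi> "- r"] U.kf.scale_left[of r _ "-1"] U.kf.scale_right[of r r "-1"]
      U.mem(4)[of r "-1"] mem
    by (simp add: F_def)
  also have "\<dots> \<le> 4 * F + 8 * R"
    using U.k_le[OF rho contraction mem(3)] by (simp add: R_def)
  finally have A: "A \<le> 4 * F + 8 * S" using RS by simp
  have "U.k (u + r) (u + r) \<le> 2 * a (u + r) (u + r)"
    using U.k_le[OF rho contraction, of "u + r"] mem by simp
  also have "\<dots> \<le> 4 * A + 4 * R"
    using U.sum_sq_le[of u r] mem by (simp add: A_def R_def)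
  finally have 1: "U.k (u + r) (u + r) \<le> 4 * A + 4 * S" using RS by simp
  have G_eq: "G = - b \<theta> u + c p \<theta>" using \<theta>[OF mem(4)] by (simp add: G_def)
  have "G\<^sup>2 \<le> 2 * (b \<theta> u)\<^sup>2 + 2 * (c p \<theta>)\<^sup>2"
    unfolding G_eq using zero_le_power2[of "b \<theta> u + c p \<theta>"] by (simp add: power2_eq_square algebra_simps)
  also have "\<dots> \<le> 2 * (A * G) + 2 * (S * G)"
  proof -
    have "(c p \<theta>)\<^sup>2 \<le> c p p * c \<theta> \<theta>" using C.cauchy_schwarz_sq[OF p_mem mem(4)] .
    also have "\<dots> \<le> S * G"
      using c_le[OF p_mem] c_le[OF mem(4)] C.nonneg[OF p_mem] C.nonneg[OF mem(4)] nn
      unfolding S_def G_def by (intro mult_mono) auto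
    finally show ?thesis using b_bound[OF mem(4) u_mem] by (simp add: A_def G_def)
  qed
  finally have "G \<le> 2 * A + 2 * S"
    using nn by - (rule le_of_sq_le_mult, auto simp: algebra_simps)
  moreover have "P.k \<theta> \<theta> \<le> G / c1"
    using spectral_lower[OF mem(4)] const_pos by (simp add: G_def field_simps)
  ultimately have 2: "P.k \<theta> \<theta> \<le> (2 * A + 2 * S) / c1"
    using const_pos by (meson divide_right_mono order.trans less_imp_le)
  define x where "x = 1 / c1"
  have x: "0 \<le> x" using const_pos by (simp add: x_def)
  have "U.k (u + r) (u + r) + P.k \<theta> \<theta> \<le> (4 + 2 * x) * (A + S)"
    using 1 2 nn x by (simp add: x_def algebra_simps add_divide_distrib)
  also have "\<dots> \<le> (4 + 2 * x) * (4 * F + 9 * (x * L))"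
    using A SL x by (intro mult_left_mono) (auto simp: x_def)
  also have "\<dots> \<le> (4 + 2 * x) * ((4 + 9 * x) * (F + L))"
    using nn x by (intro mult_left_mono) (auto simp: algebra_simps)
  also have "\<dots> = upper_const * (F + L)" by (simp add: norm_const_def x_def mult_ac)
  finally show ?thesis by (simp add: F_def L_def)
qed

end

text \<open>The system inverted by \<open>MU\<close> is solved by back substitution: the second row
  gives \<open>p = P.T \<psi>\<close>, and the first row then has right-hand side
  \<open>a \<phi> - b p = a (\<phi> - r)\<close>, so \<open>u = U.T (\<phi> - r)\<close>.\<close>

theorem field_of_values_bounds:
  fixes MU
  defines "MU \<equiv> inv_into (V \<times> Q) (\<lambda>(u, p).
     (\<lambda>v. inv_into (dual_space V) Hu u v + b p v, inv_into (dual_space Q) Hp p))"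
  assumes AA_eq: "\<And>u p. u \<in> V \<Longrightarrow> p \<in> Q \<Longrightarrow> AA (u, p) = (\<lambda>v. a u v + b p v, \<lambda>q. - b q u + c p q)"
    and x': "x' \<in> dual_space V \<times> dual_space Q" "x' \<noteq> (\<lambda>_. 0, \<lambda>_. 0)"
  shows "1 / bound_const \<le> inner_wrt (precond_D Hu Hp) (AA (MU x')) x' / inner_wrt (precond_D Hu Hp) x' x'"
    and "norm_wrt (precond_D Hu Hp) (AA (MU x')) / norm_wrt (precond_D Hu Hp) x' \<le> sqrt upper_const"
proof -
  obtain f g where fg: "x' = (f, g)" "f \<in> dual_space V" "g \<in> dual_space Q" using x' by auto
  obtain \<phi> where \<phi>: "\<phi> \<in> V" "f = a \<phi>" using U.riesz[OF fg(2)] .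
  obtain \<psi> where \<psi>: "\<psi> \<in> Q" "g = s \<psi>" using P.riesz[OF fg(3)] .
  obtain r where r: "r \<in> V" "b (P.T \<psi>) = a r"
    using U.riesz[OF b_dual[of "P.T \<psi>"]] \<psi> by auto
  define u where "u = U.T (\<phi> - r)"
  define p where "p = P.T \<psi>"
  have up: "u \<in> V" "p \<in> Q" using \<phi> \<psi> r by (auto simp: u_def p_def)
  \<comment> \<open>This is the second component of the image; its representer
    \<open>\<theta>\<close> satisfies the equation on which \<open>lower_bound\<close> and
    \<open>upper_bound\<close> are built.\<close>
  define F where "F = (\<lambda>q. - b q u + c p q)"
  have "F \<in> dual_space Q"
    using b_dual'[OF up(1)] C.dual[OF up(2)]
    by (auto simp: F_def dual_space_def algebra_simps)
  then obtain \<theta> where \<theta>: "\<theta> \<in> Q" "F = s \<theta>" using P.riesz by blast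
  have G: "(\<lambda>v. inv_into (dual_space V) Hu u v + b p v, inv_into (dual_space Q) Hp p) = x'"
  proof -
    have "inv_into (dual_space V) Hu u = a (\<phi> - r)" "inv_into (dual_space Q) Hp p = s \<psi>"
      unfolding u_def p_def using \<phi> \<psi> r by (auto simp: U.inv_H P.inv_H)
    moreover have "a (\<phi> - r) v + a r v = a \<phi> v" for v
      using \<phi> r U.outside[of "\<phi> - r" v] U.outside[of r v] U.outside[of \<phi> v]
      by (cases "v \<in> V") (auto simp: U.diff_left)
    ultimately show ?thesis using fg \<phi> \<psi> r by (simp add: p_def)
  qed
  have MU: "MU x' = (u, p)"
  proof -
    \<comment> \<open>\<open>inv_into\<close> returns the solution found above only if it is unique:
      the second component determines \<open>p\<close>, and then the first determines
      \<open>u\<close>.\<close>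
    have inj: "inj_on (\<lambda>(u, p). (\<lambda>v. inv_into (dual_space V) Hu u v + b p v,
        inv_into (dual_space Q) Hp p)) (V \<times> Q)"
    proof (rule inj_onI, clarify)
      fix u1 p1 u2 p2
      assume m: "u1 \<in> V" "p1 \<in> Q" "u2 \<in> V" "p2 \<in> Q"
        and e1: "(\<lambda>v. inv_into (dual_space V) Hu u1 v + b p1 v)
          = (\<lambda>v. inv_into (dual_space V) Hu u2 v + b p2 v)"
        and e2: "inv_into (dual_space Q) Hp p1 = inv_into (dual_space Q) Hp p2"
      obtain y1 y2 where y: "y1 \<in> Q" "P.T y1 = p1" "y2 \<in> Q" "P.T y2 = p2"
        using P.T_surj m by metis
      have "s y1 = s y2" using e2 y P.inv_H by metis
      then have p: "p1 = p2" using y by (auto simp: P.T_def)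
      obtain z1 z2 where z: "z1 \<in> V" "U.T z1 = u1" "z2 \<in> V" "U.T z2 = u2"
        using U.T_surj m by metis
      have "inv_into (dual_space V) Hu u1 = inv_into (dual_space V) Hu u2"
        using e1 p by (auto simp: fun_eq_iff)
      then have "a z1 = a z2" using z U.inv_H by metis
      then show "u1 = u2 \<and> p1 = p2" using z p by (auto simp: U.T_def)
    qed
    show ?thesis
      unfolding MU_def using inv_into_f_f[OF inj, of "(u, p)"] up G by simp
  qed
  have AA: "AA (MU x') = (a (u + r), s \<theta>)"
  proof -
    have "a u v + a r v = a (u + r) v" for v
      using up r U.outside[of u v] U.outside[of r v] U.outside[of "u + r" v]
      by (cases "v \<in> V") (auto simp: U.add_left)
    then show ?thesis using r \<theta> up by (simp add: MU AA_eq F_def p_def fun_eq_iff)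
  qed
  have \<theta>': "s \<theta> q = - b q (U.T (\<phi> - r)) + c (P.T \<psi>) q" if "q \<in> Q" for q
    using \<theta>(2) by (auto simp: F_def u_def p_def fun_eq_iff)
  define D where "D = U.k \<phi> \<phi> + P.k \<psi> \<psi>"
  have D: "inner_wrt (precond_D Hu Hp) x' x' = D"
    using \<phi> \<psi> fg
    by (simp add: inner_wrt_def precond_D_def dual_pairing_def D_def U.k_eq P.k_eq U.T_def P.T_def)
  have X: "inner_wrt (precond_D Hu Hp) (AA (MU x')) x' = U.k (u + r) \<phi> + P.k \<theta> \<psi>"
    using \<phi> \<psi> fg AA up r
    by (simp add: inner_wrt_def precond_D_def dual_pairing_def U.k_eq P.k_eq U.T_def P.T_def)
  have N: "inner_wrt (precond_D Hu Hp) (AA (MU x')) (AA (MU x')) = U.k (u + r) (u + r) + P.k \<theta> \<theta>"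
    using \<phi> \<psi> fg AA up r \<theta>
    by (simp add: inner_wrt_def precond_D_def dual_pairing_def U.k_eq P.k_eq U.T_def P.T_def)
  have "0 < D"
  proof -
    have "\<phi> \<noteq> 0 \<or> \<psi> \<noteq> 0"
      using x'(2) fg(1) \<phi>(2) \<psi>(2) U.zero_left P.zero_left by auto
    then have "U.k \<phi> \<phi> \<noteq> 0 \<or> P.k \<psi> \<psi> \<noteq> 0"
      using U.kf.definite P.kf.definite \<phi> \<psi> by blast
    then show ?thesis
      using U.kf.nonneg[OF \<phi>(1)] P.kf.nonneg[OF \<psi>(1)] by (auto simp: D_def)
  qed
  show "1 / bound_const \<le> inner_wrt (precond_D Hu Hp) (AA (MU x')) x' / inner_wrt (precond_D Hu Hp) x' x'"
    using lower_bound[OF \<phi>(1) \<psi>(1) r(1) \<theta>(1) r(2) \<theta>'] \<open>0 < D\<close> bound_const_pos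
    unfolding D X u_def by (simp add: D_def field_simps)
  have "U.k (u + r) (u + r) + P.k \<theta> \<theta> \<le> upper_const * D"
    using upper_bound[OF \<phi>(1) \<psi>(1) r(1) \<theta>(1) r(2) \<theta>'] by (simp add: D_def u_def)
  then have "(U.k (u + r) (u + r) + P.k \<theta> \<theta>) / D \<le> upper_const"
    using \<open>0 < D\<close> by (simp add: field_simps)
  then show "norm_wrt (precond_D Hu Hp) (AA (MU x')) / norm_wrt (precond_D Hu Hp) x' \<le> sqrt upper_const"
    unfolding norm_wrt_def D N by (simp flip: real_sqrt_divide)
qed

end

section \<open>Piecewise regular functions\<close>

text \<open>The regularity shared by finite element functions and their derivatives off the cell
  boundaries. Derivatives may jump there, so continuity is asked on an open set only, and
  boundedness has to be added to obtain integrability.\<close>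

definition bounded_cont :: "'a::metric_space set \<Rightarrow> ('a \<Rightarrow> 'b::metric_space) \<Rightarrow> bool" where
  "bounded_cont U f \<longleftrightarrow> continuous_on U f \<and> bounded (f ` U)"

lemma bounded_cont_cong: "(\<And>x. x \<in> U \<Longrightarrow> f x = g x) \<Longrightarrow> bounded_cont U f = bounded_cont U g"
  unfolding bounded_cont_def using continuous_on_cong[of U U f g] image_cong[of U U f g] by simp

lemma bounded_cont_add:
  fixes f g :: "_ \<Rightarrow> 'b::real_normed_vector"
  assumes "bounded_cont U f" "bounded_cont U g"
  shows "bounded_cont U (\<lambda>x. f x + g x)"
  using assms by (auto simp: bounded_cont_def intro: continuous_on_add bounded_plus_comp)

lemma bounded_cont_bilinear:
  assumes B: "bounded_bilinear B" and f: "bounded_cont U f" and g: "bounded_cont U g"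
  shows "bounded_cont U (\<lambda>x. B (f x) (g x))"
proof -
  interpret bounded_bilinear B by fact
  obtain K where K: "0 \<le> K" "\<And>a b. norm (B a b) \<le> norm a * norm b * K"
    using nonneg_bounded by blast
  obtain a b where ab: "\<And>x. x \<in> U \<Longrightarrow> norm (f x) \<le> a" "\<And>x. x \<in> U \<Longrightarrow> norm (g x) \<le> b"
    using f g by (auto simp: bounded_cont_def bounded_iff)
  have "norm (B (f x) (g x)) \<le> a * b * K" if "x \<in> U" for x
  proof -
    have "norm (f x) * norm (g x) \<le> a * b"
      using ab[OF that] order.trans[OF norm_ge_zero ab(1)[OF that]] by (intro mult_mono) auto
    then show ?thesis using K(2)[of "f x" "g x"] mult_right_mono[OF _ K(1)] by (meson order.trans)
  qed
  then show ?thesis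
    using f g continuous_on[of U f g] by (auto simp: bounded_cont_def bounded_iff)
qed

lemma bounded_cont_linear:
  assumes "bounded_linear L" "bounded_cont U f"
  shows "bounded_cont U (\<lambda>x. L (f x))"
  using assms bounded_linear.continuous_on[OF assms(1), of U f] bounded_linear_image[of "f ` U" L]
  by (auto simp: bounded_cont_def image_image)

lemma bounded_cont_scaleR:
  fixes f :: "_ \<Rightarrow> 'b::real_normed_vector"
  shows "bounded_cont U f \<Longrightarrow> bounded_cont U (\<lambda>x. c *\<^sub>R f x)"
  using bounded_cont_linear[OF bounded_linear_scaleR_right] .

lemma bounded_cont_inner:
  fixes f g :: "_ \<Rightarrow> 'b::real_inner"
  shows "bounded_cont U f \<Longrightarrow> bounded_cont U g \<Longrightarrow> bounded_cont U (\<lambda>x. f x \<bullet> g x)"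
  by (rule bounded_cont_bilinear[OF bounded_bilinear_inner])

lemma bounded_cont_vec:
  fixes f :: "_ \<Rightarrow> 'b::real_normed_vector ^ 'n"
  assumes "\<And>i. bounded_cont U (\<lambda>x. f x $ i)"
  shows "bounded_cont U f"
proof -
  have "continuous_on U (\<lambda>x. \<chi> i. f x $ i)"
    using assms by (intro continuous_on_vec_lambda) (auto simp: bounded_cont_def)
  moreover have "bounded (f ` U)"
  proof -
    have "\<forall>i. \<exists>b. \<forall>x \<in> U. norm (f x $ i) \<le> b"
      using assms by (auto simp: bounded_cont_def bounded_iff)
    then obtain b where b: "\<And>i x. x \<in> U \<Longrightarrow> norm (f x $ i) \<le> b i" by metis
    have "norm (f x) \<le> (\<Sum>i\<in>UNIV. b i)" if "x \<in> U" for x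
    proof -
      have "norm (f x) \<le> (\<Sum>i\<in>UNIV. norm (f x $ i))"
        unfolding norm_vec_def by (rule L2_set_le_sum) simp
      also have "\<dots> \<le> (\<Sum>i\<in>UNIV. b i)" using b[OF that] by (rule sum_mono)
      finally show ?thesis .
    qed
    then show ?thesis by (auto simp: bounded_iff)
  qed
  ultimately show ?thesis by (simp add: bounded_cont_def)
qed

section \<open>Differentiable functions with bounded continuous gradient\<close>

definition C1_bounded :: "(real^'n) set \<Rightarrow> (real^'n \<Rightarrow> real) \<Rightarrow> bool" where
  "C1_bounded U f \<longleftrightarrow> bounded_cont U f \<and> (\<forall>x \<in> U. f differentiable at x) \<and> bounded_cont U (grad f)"

lemma grad_eq:
  assumes "(f has_derivative (\<lambda>h. g \<bullet> h)) (at x)"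
  shows "grad f x = g"
  unfolding grad_def frechet_derivative_at[OF assms, symmetric]
  by (simp add: vec_eq_iff inner_axis)

lemma has_derivative_grad:
  assumes "f differentiable at x"
  shows "(f has_derivative (\<lambda>h. grad f x \<bullet> h)) (at x)"
proof -
  let ?D = "frechet_derivative f (at x)"
  have D: "(f has_derivative ?D) (at x)" using assms frechet_derivative_works by blast
  then have lin: "linear ?D" using has_derivative_linear by blast
  have "?D h = grad f x \<bullet> h" for h
  proof -
    have "?D h = ?D (\<Sum>i\<in>UNIV. h $ i *\<^sub>R axis i 1)"
      by (simp add: basis_expansion flip: scalar_mult_eq_scaleR)
    also have "\<dots> = (\<Sum>i\<in>UNIV. h $ i * ?D (axis i 1))"
      by (simp add: linear_sum[OF lin] linear_scale[OF lin])
    finally show ?thesis by (simp add: grad_def inner_vec_def mult.commute)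
  qed
  then have "?D = (\<lambda>h. grad f x \<bullet> h)" by (rule ext)
  then show ?thesis using D by simp
qed

lemma C1_boundedI:
  assumes "bounded_cont U f" "bounded_cont U g"
    "\<And>x. x \<in> U \<Longrightarrow> (f has_derivative (\<lambda>h. g x \<bullet> h)) (at x)"
  shows "C1_bounded U f"
  using assms bounded_cont_cong[of U "grad f" g] grad_eq[OF assms(3)]
  by (auto simp: C1_bounded_def differentiable_def)

lemma grad_add:
  assumes "f differentiable at x" "g differentiable at x"
  shows "grad (\<lambda>x. f x + g x) x = grad f x + grad g x"
  by (rule grad_eq) (use has_derivative_add[OF has_derivative_grad[OF assms(1)] has_derivative_grad[OF assms(2)]]
      in \<open>simp add: inner_add_left\<close>)

lemma grad_scale:
  assumes "f differentiable at x"
  shows "grad (\<lambda>x. c * f x) x = c *\<^sub>R grad f x"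
  by (rule grad_eq) (use has_derivative_mult_right[OF has_derivative_grad[OF assms], of c] in simp)

lemma C1_bounded_add:
  assumes "C1_bounded U f" "C1_bounded U g"
  shows "C1_bounded U (\<lambda>x. f x + g x)"
  using assms bounded_cont_add[of U "grad f" "grad g"]
  by (intro C1_boundedI[where g = "\<lambda>x. grad f x + grad g x"])
    (auto simp: C1_bounded_def inner_add_left intro: bounded_cont_add has_derivative_add has_derivative_grad)

lemma C1_bounded_scale:
  assumes "C1_bounded U f"
  shows "C1_bounded U (\<lambda>x. c * f x)"
  using assms bounded_cont_scaleR[of U f c]
  by (intro C1_boundedI[where g = "\<lambda>x. c *\<^sub>R grad f x"])
    (auto simp: C1_bounded_def intro: bounded_cont_scaleR has_derivative_mult_right has_derivative_grad)

section \<open>Vector fields, strain and divergence\<close>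

definition C1_field :: "(real^'n) set \<Rightarrow> (real^'n \<Rightarrow> real^'n) \<Rightarrow> bool" where
  "C1_field U v \<longleftrightarrow> (\<forall>i. C1_bounded U (\<lambda>x. v x $ i))"

lemma grad_vec_component:
  fixes v :: "real^'n \<Rightarrow> real^'n"
  assumes "C1_field U v" "x \<in> U"
  shows "grad_vec v x $ i = grad (\<lambda>x. v x $ i) x"
proof -
  have "(v has_derivative (\<lambda>h. \<chi> i. grad (\<lambda>x. v x $ i) x \<bullet> h)) (at x)"
    unfolding has_derivative_componentwise_within[of v]
  proof
    fix b :: "real^'n" assume "b \<in> Basis"
    then obtain j where b: "b = axis j 1" by (auto simp: Basis_vec_def)
    have "((\<lambda>x. v x $ j) has_derivative (\<lambda>h. grad (\<lambda>x. v x $ j) x \<bullet> h)) (at x)"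
      using assms by (intro has_derivative_grad) (auto simp: C1_field_def C1_bounded_def)
    then show "((\<lambda>x. v x \<bullet> b) has_derivative (\<lambda>h. (\<chi> i. grad (\<lambda>x. v x $ i) x \<bullet> h) \<bullet> b)) (at x)"
      by (simp add: b inner_axis)
  qed
  then have "frechet_derivative v (at x) = (\<lambda>h. \<chi> i. grad (\<lambda>x. v x $ i) x \<bullet> h)"
    using frechet_derivative_at by metis
  then show ?thesis
    by (simp add: grad_vec_def jacobian_def matrix_def vec_eq_iff inner_axis)
qed

lemma has_derivative_field:
  fixes v :: "real^'n \<Rightarrow> real^'n"
  assumes "C1_field U v" "x \<in> U"
  shows "(v has_derivative (\<lambda>h. grad_vec v x *v h)) (at x)"
  unfolding has_derivative_componentwise_within[of v]
proof
  fix b :: "real^'n" assume "b \<in> Basis"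
  then obtain j where b: "b = axis j 1" by (auto simp: Basis_vec_def)
  have "((\<lambda>x. v x $ j) has_derivative (\<lambda>h. grad (\<lambda>x. v x $ j) x \<bullet> h)) (at x)"
    using assms by (intro has_derivative_grad) (auto simp: C1_field_def C1_bounded_def)
  then show "((\<lambda>x. v x \<bullet> b) has_derivative (\<lambda>h. (grad_vec v x *v h) \<bullet> b)) (at x)"
    using grad_vec_component[OF assms, of j]
    by (simp add: b inner_axis matrix_vector_mul_component)
qed

lemma C1_field_bounded_cont:
  assumes "C1_field U v"
  shows "bounded_cont U v" and "bounded_cont U (grad_vec v)"
proof -
  show "bounded_cont U v"
    using assms by (intro bounded_cont_vec) (auto simp: C1_field_def C1_bounded_def)
  have "bounded_cont U (\<lambda>x. grad_vec v x $ i)" for i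
    using assms grad_vec_component[OF assms, of _ i]
      bounded_cont_cong[of U "\<lambda>x. grad_vec v x $ i" "grad (\<lambda>x. v x $ i)"]
    by (auto simp: C1_field_def C1_bounded_def)
  then show "bounded_cont U (grad_vec v)" by (rule bounded_cont_vec)
qed

lemma grad_vec_add:
  assumes "C1_field U v" "C1_field U w" "x \<in> U"
  shows "grad_vec (\<lambda>x. v x + w x) x = grad_vec v x + grad_vec w x"
proof -
  have vw: "C1_field U (\<lambda>x. v x + w x)"
    using assms by (auto simp: C1_field_def intro: C1_bounded_add)
  show ?thesis
    using assms grad_add[of "\<lambda>x. v x $ i" x "\<lambda>x. w x $ i" for i]
    by (simp add: vec_eq_iff[of _ "_ + _"] grad_vec_component[OF vw assms(3)]
        grad_vec_component[OF assms(1,3)] grad_vec_component[OF assms(2,3)])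
      (simp add: C1_field_def C1_bounded_def grad_add)
qed

lemma grad_vec_scale:
  assumes "C1_field U v" "x \<in> U"
  shows "grad_vec (\<lambda>x. c *\<^sub>R v x) x = c *\<^sub>R grad_vec v x"
proof -
  have cv: "C1_field U (\<lambda>x. c *\<^sub>R v x)"
    using assms by (auto simp: C1_field_def intro: C1_bounded_scale)
  show ?thesis
    using assms
    by (simp add: vec_eq_iff[of _ "_ *\<^sub>R _"] grad_vec_component[OF cv assms(2)]
        grad_vec_component[OF assms])
      (simp add: C1_field_def C1_bounded_def grad_scale)
qed

lemma bounded_linear_trace: "bounded_linear (trace :: real^'n^'n \<Rightarrow> real)"
  by (rule linear_conv_bounded_linear[THEN iffD1]) (auto intro!: linearI simp: trace_def sum.distrib sum_distrib_left)

lemma bounded_linear_transpose: "bounded_linear (transpose :: real^'n^'n \<Rightarrow> real^'n^'n)"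
  by (rule linear_conv_bounded_linear[THEN iffD1]) (auto intro!: linearI simp: transpose_def vec_eq_iff)

lemma bounded_cont_strain: "C1_field U v \<Longrightarrow> bounded_cont U (strain v)"
  unfolding strain_def
  by (intro bounded_cont_scaleR bounded_cont_add bounded_cont_linear[OF bounded_linear_transpose]
      C1_field_bounded_cont)

lemma bounded_cont_divergence: "C1_field U v \<Longrightarrow> bounded_cont U (divergence v)"
  unfolding divergence_def
  by (intro bounded_cont_linear[OF bounded_linear_trace] C1_field_bounded_cont)

lemma strain_add:
  "C1_field U v \<Longrightarrow> C1_field U w \<Longrightarrow> x \<in> U \<Longrightarrow> strain (\<lambda>x. v x + w x) x = strain v x + strain w x"
  by (simp add: strain_def grad_vec_add linear_add[OF bounded_linear.linear[OF bounded_linear_transpose]]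
      algebra_simps)

lemma strain_scale:
  "C1_field U v \<Longrightarrow> x \<in> U \<Longrightarrow> strain (\<lambda>x. c *\<^sub>R v x) x = c *\<^sub>R strain v x"
  by (simp add: strain_def grad_vec_scale linear_scale[OF bounded_linear.linear[OF bounded_linear_transpose]]
      algebra_simps)

lemma divergence_add:
  "C1_field U v \<Longrightarrow> C1_field U w \<Longrightarrow> x \<in> U \<Longrightarrow>
    divergence (\<lambda>x. v x + w x) x = divergence v x + divergence w x"
  by (simp add: divergence_def grad_vec_add linear_add[OF bounded_linear.linear[OF bounded_linear_trace]])

lemma divergence_scale:
  "C1_field U v \<Longrightarrow> x \<in> U \<Longrightarrow> divergence (\<lambda>x. c *\<^sub>R v x) x = c * divergence v x"
  by (simp add: divergence_def grad_vec_scale linear_scale[OF bounded_linear.linear[OF bounded_linear_trace]])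

text \<open>Transposition preserves the trace. This is how the strain term of the elasticity form
  contributes \<open>2 * \<mu> / d\<close> to the weight of the divergence.\<close>

lemma divergence_eq_trace_strain: "divergence v x = trace (strain v x)"
  by (simp add: divergence_def strain_def trace_def transpose_def)

section \<open>The \<open>L\<^sup>2\<close> inner product\<close>

lemma integrable_bounded_cont:
  fixes f :: "'a::euclidean_space \<Rightarrow> real"
  assumes "open W" "bounded W" "bounded_cont W f"
  shows "set_integrable lebesgue W f"
proof -
  obtain B where B: "\<And>x. x \<in> W \<Longrightarrow> norm (f x) \<le> B"
    using assms(3) by (auto simp: bounded_cont_def bounded_iff)
  have W: "W \<in> lmeasurable" using assms lmeasurable_open by blast
  have "(\<lambda>x. indicator W x *\<^sub>R f x) \<in> borel_measurable lborel"
    using assms borel_measurable_continuous_on_indicator[of W f] by (simp add: bounded_cont_def)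
  then have "(\<lambda>x. indicator W x *\<^sub>R f x) \<in> borel_measurable lebesgue"
    by (rule measurable_completion)
  then show ?thesis
    unfolding set_integrable_def
    using W B fmeasurableD2[OF W]
    by (intro integrableI_bounded_set[where A = W and B = B])
      (auto simp: fmeasurableD less_top indicator_def)
qed

text \<open>\<open>\<Omega>\<close> carries the integration and \<open>U\<close> the regularity;
  neither has to contain the other. Pointwise hypotheses below are demanded on \<open>U\<close>
  only, and integrands are altered freely on the null set \<open>- U\<close>.\<close>

locale L2_domain =
  fixes \<Omega> U :: "(real^'n) set"
  assumes open_domain: "open \<Omega>" and bounded_domain: "bounded \<Omega>"
    and open_U: "open U" and negligible_compl: "negligible (- U)"
begin

lemma absolutely_integrable:
  fixes f :: "real^'n \<Rightarrow> real"
  assumes "bounded_cont U f"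
  shows "f absolutely_integrable_on \<Omega>"
proof -
  have "bounded_cont (\<Omega> \<inter> U) f"
    using assms by (auto simp: bounded_cont_def intro: continuous_on_subset bounded_subset)
  then have "set_integrable lebesgue (\<Omega> \<inter> U) f"
    using open_domain bounded_domain open_U by (intro integrable_bounded_cont) (auto intro: bounded_subset)
  then have "set_integrable lebesgue \<Omega> (\<lambda>x. if x \<in> U then f x else 0)"
    unfolding set_integrable_def by (rule Bochner_Integration.integrable_cong[OF refl, THEN iffD1, rotated])
      (auto simp: indicator_def)
  then show ?thesis
    by (rule absolutely_integrable_spike[OF _ negligible_compl]) auto
qed

lemma L2_inner_eq:
  fixes f g :: "real^'n \<Rightarrow> 'b::real_inner"
  assumes "bounded_cont U f" "bounded_cont U g"
  shows "L2_inner \<Omega> f g = integral \<Omega> (\<lambda>x. f x \<bullet> g x)" "(\<lambda>x. f x \<bullet> g x) integrable_on \<Omega>"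
  unfolding L2_inner_def
  using set_lebesgue_integral_eq_integral[OF absolutely_integrable[OF bounded_cont_inner[OF assms]]] by auto

lemma L2_inner_commute:
  fixes f g :: "real^'n \<Rightarrow> 'b::real_inner"
  shows "L2_inner \<Omega> f g = L2_inner \<Omega> g f"
  by (simp add: L2_inner_def inner_commute)

lemma L2_inner_cong:
  fixes f g :: "real^'n \<Rightarrow> 'b::real_inner"
  assumes "bounded_cont U f" "bounded_cont U g" "\<And>x. x \<in> U \<Longrightarrow> f x = f' x" "\<And>x. x \<in> U \<Longrightarrow> g x = g' x"
  shows "L2_inner \<Omega> f g = L2_inner \<Omega> f' g'"
proof -
  have "bounded_cont U f'" "bounded_cont U g'"
    using assms bounded_cont_cong[of U f f'] bounded_cont_cong[of U g g'] by auto
  then show ?thesis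
    using assms by (simp add: L2_inner_eq, intro integral_spike[OF negligible_compl]) auto
qed

text \<open>The sum is described by an equation on \<open>U\<close> instead of a lambda term,
  because derivatives of finite element functions are known to add up only there.\<close>

lemma L2_inner_add:
  fixes f g h :: "real^'n \<Rightarrow> 'b::real_inner"
  assumes "bounded_cont U f" "bounded_cont U g" "bounded_cont U h" "\<And>x. x \<in> U \<Longrightarrow> fg x = f x + g x"
  shows "L2_inner \<Omega> fg h = L2_inner \<Omega> f h + L2_inner \<Omega> g h"
proof -
  have "L2_inner \<Omega> (\<lambda>x. f x + g x) h = L2_inner \<Omega> fg h"
    using assms by (intro L2_inner_cong bounded_cont_add) auto
  then show ?thesis
    using assms by (simp add: L2_inner_eq bounded_cont_add inner_add_left integral_add)
qed

lemma L2_inner_scale: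
  fixes f h :: "real^'n \<Rightarrow> 'b::real_inner"
  assumes "bounded_cont U f" "bounded_cont U h" "\<And>x. x \<in> U \<Longrightarrow> cf x = c *\<^sub>R f x"
  shows "L2_inner \<Omega> cf h = c * L2_inner \<Omega> f h"
proof -
  have "L2_inner \<Omega> (\<lambda>x. c *\<^sub>R f x) h = L2_inner \<Omega> cf h"
    using assms by (intro L2_inner_cong bounded_cont_scaleR) auto
  then show ?thesis
    using assms by (simp add: L2_inner_eq bounded_cont_scaleR)
qed

text \<open>The ranges of \<open>f\<close> and \<open>g\<close> may differ: the scalar divergence is
  compared with the matrix-valued strain or gradient.\<close>

lemma L2_inner_le:
  fixes f :: "real^'n \<Rightarrow> 'b::real_inner" and g :: "real^'n \<Rightarrow> 'c::real_inner"
  assumes "bounded_cont U f" "bounded_cont U g" "\<And>x. x \<in> U \<Longrightarrow> f x \<bullet> f x \<le> C * (g x \<bullet> g x)"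
  shows "L2_inner \<Omega> f f \<le> C * L2_inner \<Omega> g g"
proof -
  have "integral \<Omega> (\<lambda>x. f x \<bullet> f x) \<le> integral \<Omega> (\<lambda>x. C * (g x \<bullet> g x))"
  proof -
    let ?F = "\<lambda>x. if x \<in> U then f x \<bullet> f x else 0" and ?G = "\<lambda>x. if x \<in> U then C * (g x \<bullet> g x) else 0"
    have int: "(\<lambda>x. f x \<bullet> f x) integrable_on \<Omega>" "(\<lambda>x. C * (g x \<bullet> g x)) integrable_on \<Omega>"
      using L2_inner_eq(2) assms(1,2) integrable_cmul[of "\<lambda>x. g x \<bullet> g x" \<Omega> C] by auto
    have "integral \<Omega> ?F \<le> integral \<Omega> ?G"
      using assms(3) int
      by (intro integral_le integrable_spike[OF int(1) negligible_compl] integrable_spike[OF int(2) negligible_compl])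
        auto
    moreover have "integral \<Omega> (\<lambda>x. f x \<bullet> f x) = integral \<Omega> ?F"
      "integral \<Omega> (\<lambda>x. C * (g x \<bullet> g x)) = integral \<Omega> ?G"
      by (rule integral_spike[OF negligible_compl]; simp)+
    ultimately show ?thesis by simp
  qed
  then show ?thesis using assms by (simp add: L2_inner_eq)
qed

lemma L2_inner_nonneg: "0 \<le> L2_inner \<Omega> f f"
  unfolding L2_inner_def set_lebesgue_integral_def
  by (rule Bochner_Integration.integral_nonneg) (simp add: indicator_def)

lemma L2_norm_sq: "(L2_norm \<Omega> f)\<^sup>2 = L2_inner \<Omega> f f"
  by (simp add: L2_norm_def L2_inner_nonneg)

text \<open>The set where \<open>f\<close> is nonzero is open in \<open>\<Omega> \<inter> U\<close>
  and null, hence empty; this gives the conclusion at every point and not just almost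
  everywhere.\<close>

lemma L2_inner_eq_0D:
  fixes f :: "real^'n \<Rightarrow> 'b::real_inner"
  assumes f: "bounded_cont U f" and 0: "L2_inner \<Omega> f f = 0" and x: "x \<in> \<Omega>" "x \<in> U"
  shows "f x = 0"
proof (rule ccontr)
  assume "f x \<noteq> 0"
  let ?N = "{x \<in> \<Omega> \<inter> U. f x \<noteq> 0}"
  have int: "integrable lebesgue (\<lambda>x. indicator \<Omega> x *\<^sub>R (f x \<bullet> f x))"
    using absolutely_integrable[OF bounded_cont_inner[OF f f]] by (simp add: set_integrable_def)
  have "AE x in lebesgue. indicator \<Omega> x *\<^sub>R (f x \<bullet> f x) = 0"
    using integral_nonneg_eq_0_iff_AE[OF int] 0
    by (simp add: L2_inner_def set_lebesgue_integral_def)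
  then have ae: "AE x in lebesgue. x \<notin> ?N"
    by (rule AE_mp) (auto simp: indicator_def)
  have "open (\<Omega> \<inter> U)" using open_domain open_U by blast
  moreover have "continuous_on (\<Omega> \<inter> U) f"
    using f by (auto simp: bounded_cont_def intro: continuous_on_subset)
  ultimately have op: "open ?N"
    using continuous_open_preimage[of "\<Omega> \<inter> U" f "- {0}"] by (simp add: vimage_def Int_def open_Compl)
  then have "?N \<in> null_sets lebesgue"
    using ae by (subst AE_iff_null_sets) auto
  then have "negligible ?N" by (simp add: negligible_iff_null_sets)
  moreover have "?N \<noteq> {}" using x \<open>f x \<noteq> 0\<close> by auto
  ultimately show False using op open_not_negligible by blast
qed

lemma L2_cauchy_schwarz:
  fixes f g :: "real^'n \<Rightarrow> 'b::real_inner"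
  assumes "bounded_cont U f" "bounded_cont U g"
  shows "(L2_inner \<Omega> f g)\<^sup>2 \<le> L2_inner \<Omega> f f * L2_inner \<Omega> g g"
proof (rule discriminant_le)
  fix t
  let ?h = "\<lambda>x. f x + t *\<^sub>R g x"
  have tg: "bounded_cont U (\<lambda>x. t *\<^sub>R g x)" using assms bounded_cont_scaleR by blast
  have h: "bounded_cont U ?h" using bounded_cont_add[OF assms(1) tg] .
  have e: "L2_inner \<Omega> ?h k = L2_inner \<Omega> f k + t * L2_inner \<Omega> g k" if "bounded_cont U k" for k
    using L2_inner_add[OF assms(1) tg that, of ?h] L2_inner_scale[OF assms(2) that, of "\<lambda>x. t *\<^sub>R g x" t]
    by simp
  have "0 \<le> L2_inner \<Omega> ?h ?h" by (rule L2_inner_nonneg)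
  also have "\<dots> = L2_inner \<Omega> f ?h + t * L2_inner \<Omega> g ?h" by (rule e[OF h])
  also have "\<dots> = L2_inner \<Omega> f f + 2 * t * L2_inner \<Omega> f g + t\<^sup>2 * L2_inner \<Omega> g g"
    using e[OF assms(1)] e[OF assms(2)]
    by (simp add: L2_inner_commute[of _ ?h] L2_inner_commute[of g f] power2_eq_square algebra_simps)
  finally show "0 \<le> L2_inner \<Omega> f f + 2 * t * L2_inner \<Omega> f g + t\<^sup>2 * L2_inner \<Omega> g g" .
qed (rule L2_inner_nonneg)

end

section \<open>Finite element functions\<close>

text \<open>Models the polynomial with which a finite element function agrees on one cell. It lives
  on the whole space, so that it and its gradient are continuous up to the cell boundary.\<close>

definition smooth_with_grad :: "('a::real_inner \<Rightarrow> real) \<Rightarrow> ('a \<Rightarrow> 'a) \<Rightarrow> bool" where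
  "smooth_with_grad F G \<longleftrightarrow>
     (\<forall>x. (F has_derivative (\<lambda>h. G x \<bullet> h)) (at x)) \<and> continuous_on UNIV G"

lemma smooth_with_grad_continuous: "smooth_with_grad F G \<Longrightarrow> continuous_on S F"
  unfolding smooth_with_grad_def
  by (meson continuous_at_imp_continuous_on has_derivative_continuous)

lemma smooth_with_grad_affine: "smooth_with_grad (\<lambda>x. a \<bullet> x + b) (\<lambda>_. a)"
  unfolding smooth_with_grad_def by (auto intro!: derivative_eq_intros)

lemma smooth_with_grad_add:
  assumes "smooth_with_grad F G" "smooth_with_grad F' G'"
  shows "smooth_with_grad (\<lambda>x. F x + F' x) (\<lambda>x. G x + G' x)"
proof -
  have "((\<lambda>x. F x + F' x) has_derivative (\<lambda>h. (G x + G' x) \<bullet> h)) (at x)" for x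
    using assms has_derivative_add[of F "\<lambda>h. G x \<bullet> h" "at x" F' "\<lambda>h. G' x \<bullet> h"]
    unfolding smooth_with_grad_def inner_add_left by blast
  then show ?thesis using assms by (auto simp: smooth_with_grad_def intro: continuous_on_add)
qed

lemma smooth_with_grad_mult:
  assumes "smooth_with_grad F G" "smooth_with_grad F' G'"
  shows "smooth_with_grad (\<lambda>x. F x * F' x) (\<lambda>x. F x *\<^sub>R G' x + F' x *\<^sub>R G x)"
proof -
  have "((\<lambda>x. F x * F' x) has_derivative (\<lambda>h. (F x *\<^sub>R G' x + F' x *\<^sub>R G x) \<bullet> h)) (at x)" for x
    using assms has_derivative_mult[of F "\<lambda>h. G x \<bullet> h" x UNIV F' "\<lambda>h. G' x \<bullet> h"]
    by (simp add: smooth_with_grad_def inner_add_left mult.commute)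
  then show ?thesis
    using assms smooth_with_grad_continuous[OF assms(1)] smooth_with_grad_continuous[OF assms(2)]
    by (auto simp: smooth_with_grad_def intro!: continuous_intros)
qed

lemma smooth_with_grad_prod:
  assumes "finite C"
  shows "\<exists>G. smooth_with_grad (\<lambda>x. \<Prod>v\<in>C. a v \<bullet> x + b v) G"
  using assms
proof induction
  case empty
  then show ?case using smooth_with_grad_affine[of 0 1] by auto
next
  case (insert v C)
  then show ?case using smooth_with_grad_mult[OF smooth_with_grad_affine[of "a v" "b v"]] by fastforce
qed

text \<open>Translation by another vertex \<open>w0\<close> turns affine into linear independence,
  so some linear functional is 1 at \<open>v - w0\<close> and 0 at the other translated vertices;
  \<open>adjoint g 1\<close> is the vector representing it.\<close>

lemma affine_independent_coordinate:
  fixes C :: "'a::euclidean_space set"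
  assumes "\<not> affine_dependent C" "v \<in> C"
  shows "\<exists>a b. a \<bullet> v + b = 1 \<and> (\<forall>w \<in> C - {v}. a \<bullet> w + b = 0)"
proof (cases "C = {v}")
  case True
  then show ?thesis by (intro exI[of _ 0] exI[of _ 1]) auto
next
  case False
  then obtain w0 where w0: "w0 \<in> C" "w0 \<noteq> v" using assms by blast
  have "independent ((\<lambda>x. - w0 + x) ` (C - {w0}))"
    using assms(1) affine_dependent_iff_dependent2[OF w0(1)] by blast
  from linear_independent_extend[OF this, of "\<lambda>x. if x = v - w0 then 1 else 0 :: real"]
  obtain g :: "'a \<Rightarrow> real" where g: "linear g"
    and gw: "\<And>w. w \<in> C \<Longrightarrow> w \<noteq> w0 \<Longrightarrow> g (w - w0) = (if w = v then 1 else 0)"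
    by (auto simp: algebra_simps)
  have eq: "adjoint g 1 \<bullet> x + - g w0 = g (x - w0)" for x
    using adjoint_works[OF g, of x 1] linear_diff[OF g, of x w0] by (simp add: inner_commute)
  show ?thesis
  proof (intro exI conjI ballI)
    show "adjoint g 1 \<bullet> v + - g w0 = 1" unfolding eq using gw[of v] w0 assms by simp
    fix w assume "w \<in> C - {v}"
    then show "adjoint g 1 \<bullet> w + - g w0 = 0"
      unfolding eq using gw[of w] linear_0[OF g] by (cases "w = w0") auto
  qed
qed

text \<open>Applying the affine function of a vertex to a convex combination isolates the weight of
  that vertex. This gives uniqueness of the weights, hence a meaningful \<open>THE\<close>, and the
  affine formula at once.\<close>

lemma barycentric_affine:
  fixes C :: "(real^'n) set"
  assumes "\<not> affine_dependent C"
  shows "\<exists>a b. \<forall>x \<in> convex hull C. \<forall>v \<in> C. barycentric C x v = a v \<bullet> x + b v"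
proof -
  have fin: "finite C" using assms aff_independent_finite by blast
  obtain a b where ab: "\<And>v. v \<in> C \<Longrightarrow> a v \<bullet> v + b v = 1"
    "\<And>v w. v \<in> C \<Longrightarrow> w \<in> C \<Longrightarrow> w \<noteq> v \<Longrightarrow> a v \<bullet> w + b v = 0"
    using affine_independent_coordinate[OF assms] by (metis DiffI empty_iff insert_iff)
  have coord: "l v = a v \<bullet> x + b v"
    if l: "sum l C = 1" "(\<Sum>w\<in>C. l w *\<^sub>R w) = x" and v: "v \<in> C" for l x v
  proof -
    have "a v \<bullet> x + b v = (\<Sum>w\<in>C. l w * (a v \<bullet> w)) + sum l C * b v"
      unfolding l(1) l(2)[symmetric] by (simp add: inner_sum_right)
    also have "\<dots> = (\<Sum>w\<in>C. l w * (a v \<bullet> w + b v))"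
      by (simp add: sum_distrib_right sum.distrib distrib_left)
    also have "\<dots> = (\<Sum>w\<in>C. if w = v then l w else 0)"
      using ab v by (intro sum.cong) auto
    also have "\<dots> = l v" using v fin by simp
    finally show ?thesis by simp
  qed
  have "barycentric C x v = a v \<bullet> x + b v" if x: "x \<in> convex hull C" and v: "v \<in> C" for x v
  proof -
    obtain u where u: "sum u C = 1" "(\<Sum>w\<in>C. u w *\<^sub>R w) = x"
      using x convex_hull_finite[OF fin] by auto
    let ?P = "\<lambda>l. (\<forall>v. v \<notin> C \<longrightarrow> l v = 0) \<and> sum l C = 1 \<and> (\<Sum>v\<in>C. l v *\<^sub>R v) = x"
    \<comment> \<open>Weights are unique as functions only after being set to zero off
      \<open>C\<close>, as the definition of \<open>barycentric\<close> demands.\<close>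
    define l where "l = (\<lambda>v. if v \<in> C then u v else 0)"
    have "sum l C = sum u C" "(\<Sum>v\<in>C. l v *\<^sub>R v) = (\<Sum>w\<in>C. u w *\<^sub>R w)"
      by (auto simp: l_def intro: sum.cong)
    then have P: "?P l" using u by (simp add: l_def)
    have "barycentric C x = l"
      unfolding barycentric_def
    proof (rule the_equality)
      fix m assume m: "?P m"
      show "m = l"
      proof
        fix w show "m w = l w"
          using m P coord[of m x w] coord[of l x w] by (cases "w \<in> C") auto
      qed
    qed (rule P)
    then show ?thesis using coord[of l x v] P v by simp
  qed
  then show ?thesis by blast
qed

lemma bubble_smooth:
  fixes T :: "(real^'n) set"
  assumes "m simplex T"
  shows "\<exists>F G. smooth_with_grad F G \<and> (\<forall>x \<in> T. bubble T x = F x)"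
proof -
  obtain C where C: "finite C" "\<not> affine_dependent C" "T = convex hull C"
    using assms simplex by blast
  have ext: "{v. v extreme_point_of T} = C"
    using extreme_point_of_convex_hull_affine_independent[OF C(2)] C(3) by auto
  obtain a b where ab: "\<And>x v. x \<in> T \<Longrightarrow> v \<in> C \<Longrightarrow> barycentric C x v = a v \<bullet> x + b v"
    using barycentric_affine[OF C(2)] C(3) by metis
  obtain G where "smooth_with_grad (\<lambda>x. \<Prod>v\<in>C. a v \<bullet> x + b v) G"
    using smooth_with_grad_prod[OF C(1)] by blast
  moreover have "bubble T x = (\<Prod>v\<in>C. a v \<bullet> x + b v)" if "x \<in> T" for x
    using that ab by (simp add: bubble_def ext)
  ultimately show ?thesis by blast
qed

lemma MINI_functionsI:
  assumes "q \<in> P1_functions \<T>" "\<And>x. w x = q x + (\<Sum>T\<in>\<T>. c T * bubble T x)"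
  shows "w \<in> MINI_functions \<T>"
  unfolding MINI_functions_def using assms by (intro CollectI bexI[of _ q] exI[of _ c]) auto

text \<open>All bubble coefficients are zero. Regularity and finite dimension therefore need to be
  proved for MINI functions only, which covers both element pairs and the pressure space.\<close>

lemma P1_subset_MINI: "P1_functions \<T> \<subseteq> MINI_functions \<T>"
  by (rule subsetI, erule MINI_functionsI[where c = "\<lambda>_. 0"]) simp

lemma P1_functions_affine:
  assumes "q \<in> P1_functions \<T>" "T \<in> \<T>"
  obtains a b where "\<And>x. x \<in> T \<Longrightarrow> q x = a \<bullet> x + b"
  using assms by (auto simp: P1_functions_def)

lemma P1_functions_add:
  assumes "p \<in> P1_functions \<T>" "q \<in> P1_functions \<T>"
  shows "(\<lambda>x. p x + q x) \<in> P1_functions \<T>"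
proof -
  have "\<exists>a b. \<forall>x \<in> T. p x + q x = a \<bullet> x + b" if T: "T \<in> \<T>" for T
  proof -
    obtain a b where "\<And>x. x \<in> T \<Longrightarrow> p x = a \<bullet> x + b"
      using P1_functions_affine[OF assms(1) T] by blast
    moreover obtain a' b' where "\<And>x. x \<in> T \<Longrightarrow> q x = a' \<bullet> x + b'"
      using P1_functions_affine[OF assms(2) T] by blast
    ultimately show ?thesis by (intro exI[of _ "a + a'"] exI[of _ "b + b'"]) (simp add: inner_add_left)
  qed
  then show ?thesis using assms by (auto simp: P1_functions_def intro: continuous_on_add)
qed

lemma P1_functions_scale:
  assumes "p \<in> P1_functions \<T>"
  shows "(\<lambda>x. c * p x) \<in> P1_functions \<T>"
proof -
  have "\<exists>a b. \<forall>x \<in> T. c * p x = a \<bullet> x + b" if T: "T \<in> \<T>" for T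
  proof -
    obtain a b where "\<And>x. x \<in> T \<Longrightarrow> p x = a \<bullet> x + b"
      using P1_functions_affine[OF assms T] by blast
    then show ?thesis by (intro exI[of _ "c *\<^sub>R a"] exI[of _ "c * b"]) (simp add: distrib_left)
  qed
  then show ?thesis using assms by (auto simp: P1_functions_def intro: continuous_on_mult_left)
qed

lemma P1_functions_zero: "(\<lambda>x. 0) \<in> P1_functions \<T>"
  by (auto simp: P1_functions_def intro: exI[of _ 0])

lemma MINI_functions_add:
  assumes "v \<in> MINI_functions \<T>" "w \<in> MINI_functions \<T>"
  shows "(\<lambda>x. v x + w x) \<in> MINI_functions \<T>"
proof -
  obtain p c q d where p: "p \<in> P1_functions \<T>" "\<forall>x. v x = p x + (\<Sum>T\<in>\<T>. c T * bubble T x)"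
    and q: "q \<in> P1_functions \<T>" "\<forall>x. w x = q x + (\<Sum>T\<in>\<T>. d T * bubble T x)"
    using assms unfolding MINI_functions_def by blast
  show ?thesis
    by (rule MINI_functionsI[OF P1_functions_add[OF p(1) q(1)], where c = "\<lambda>T. c T + d T"])
      (use p q in \<open>simp add: distrib_right sum.distrib\<close>)
qed

lemma MINI_functions_scale:
  assumes "v \<in> MINI_functions \<T>"
  shows "(\<lambda>x. t * v x) \<in> MINI_functions \<T>"
proof -
  obtain p c where p: "p \<in> P1_functions \<T>" "\<forall>x. v x = p x + (\<Sum>T\<in>\<T>. c T * bubble T x)"
    using assms unfolding MINI_functions_def by blast
  show ?thesis
    by (rule MINI_functionsI[OF P1_functions_scale[OF p(1), of t], where c = "\<lambda>T. t * c T"])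
      (use p in \<open>simp add: distrib_left sum_distrib_left mult.assoc\<close>)
qed

lemma MINI_functions_zero: "(\<lambda>x. 0) \<in> MINI_functions \<T>"
  using P1_subset_MINI P1_functions_zero by blast

lemma subspace_P1_scalar: "subspace (P1_scalar \<T>)"
  by (rule subspaceI)
    (auto simp: P1_scalar_def plus_bcontfun.rep_eq scaleR_bcontfun.rep_eq zero_bcontfun.rep_eq
      intro: P1_functions_zero P1_functions_add P1_functions_scale)

lemma subspace_P1_vector: "subspace (P1_vector \<T>)"
  by (rule subspaceI)
    (auto simp: P1_vector_def plus_bcontfun.rep_eq scaleR_bcontfun.rep_eq zero_bcontfun.rep_eq
      intro: P1_functions_zero P1_functions_add P1_functions_scale)

lemma subspace_MINI_vector: "subspace (MINI_vector \<T>)"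
  by (rule subspaceI)
    (auto simp: MINI_vector_def plus_bcontfun.rep_eq scaleR_bcontfun.rep_eq zero_bcontfun.rep_eq
      intro: MINI_functions_zero MINI_functions_add MINI_functions_scale)

lemma MINI_zero_outside:
  assumes "w \<in> MINI_functions \<T>" "x \<notin> \<Union>\<T>"
  shows "w x = 0"
proof -
  obtain q c where q: "q \<in> P1_functions \<T>" "\<And>x. w x = q x + (\<Sum>T\<in>\<T>. c T * bubble T x)"
    using assms unfolding MINI_functions_def by blast
  have "q x = 0" using q(1) assms(2) interior_subset[of "\<Union>\<T>"] by (auto simp: P1_functions_def)
  moreover have "(\<Sum>T\<in>\<T>. c T * bubble T x) = 0"
    using assms(2) by (intro sum.neutral) (auto simp: bubble_def)
  ultimately show ?thesis using q(2) by simp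
qed

section \<open>Regularity of finite element functions on a mesh\<close>

locale mesh =
  fixes \<Omega> :: "(real^'n) set" and \<T>
  assumes open_domain: "open \<Omega>" and bounded_domain: "bounded \<Omega>" and mesh: "mesh_of \<Omega> \<T>"
begin

lemma finite_mesh: "finite \<T>"
  using mesh by (simp add: mesh_of_def triangulation_def)

lemma cell_simplex: "T \<in> \<T> \<Longrightarrow> int CARD('n) simplex T"
  using mesh by (simp add: mesh_of_def)

lemma cell:
  assumes "T \<in> \<T>"
  shows "convex T" "compact T" "closed T" "interior T \<noteq> {}"
proof -
  show "convex T" "compact T" "closed T"
    using cell_simplex[OF assms] convex_simplex compact_simplex closed_simplex by auto
  have "aff_dim T = DIM(real^'n)"
    using aff_dim_simplex[OF cell_simplex[OF assms]] by simp
  then have "rel_interior T = interior T" "T \<noteq> {}"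
    using interior_rel_interior[of T] by auto
  then show "interior T \<noteq> {}"
    using rel_interior_eq_empty[OF \<open>convex T\<close>] by simp
qed

text \<open>Besides the cell interiors this contains the exterior of the mesh, where functions are
  extended by zero; its complement is a finite union of boundaries of convex sets.\<close>

definition U :: "(real^'n) set" where "U = - (\<Union>T\<in>\<T>. frontier T)"

sublocale L2_domain \<Omega> U
proof
  show "open \<Omega>" "bounded \<Omega>" by (fact open_domain bounded_domain)+
  show "open U"
    unfolding U_def using finite_mesh by (auto intro!: closed_UN open_Compl)
  show "negligible (- U)"
    unfolding U_def using finite_mesh cell
    by (auto intro!: negligible_Union simp: negligible_convex_frontier)
qed

lemma U_cases:
  assumes "x \<in> U"
  obtains T where "T \<in> \<T>" "x \<in> interior T" | "x \<notin> \<Union>\<T>"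
  using assms cell closure_closed unfolding U_def frontier_def by fastforce

text \<open>A face of a cell that meets the interior of the cell is the whole cell. Applied to the
  common face, first in \<open>T\<close> and then in \<open>T'\<close>, this gives both
  inclusions.\<close>

lemma disjoint_interiors:
  assumes "T \<in> \<T>" "T' \<in> \<T>" "x \<in> interior T" "x \<in> T'"
  shows "T' = T"
proof -
  have f: "(T \<inter> T') face_of T" "(T' \<inter> T) face_of T'"
    using mesh assms by (auto simp: mesh_of_def triangulation_def)
  have "T \<inter> T' \<inter> interior T \<noteq> {}" using assms interior_subset by blast
  then have "T \<subseteq> T'"
    using f(1) face_of_disjoint_interior[OF f(1)] by blast
  then have "interior T \<subseteq> interior T'" by (rule interior_mono)
  then have "T' \<inter> T \<inter> interior T' \<noteq> {}" using assms interior_subset by blast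
  then have "T' \<subseteq> T" using face_of_disjoint_interior[OF f(2)] by blast
  then show ?thesis using \<open>T \<subseteq> T'\<close> by blast
qed

text \<open>Near a point of \<open>U\<close> the function agrees with a single smooth piece or with
  zero, so differentiability and continuity of the gradient are local.\<close>

lemma piecewise_C1_bounded:
  assumes pieces: "\<And>T. T \<in> \<T> \<Longrightarrow> \<exists>F G. smooth_with_grad F G \<and> (\<forall>x \<in> interior T. f x = F x)"
    and zero: "\<And>x. x \<notin> \<Union>\<T> \<Longrightarrow> f x = 0"
  shows "C1_bounded U f"
proof -
  obtain F G where FG: "\<And>T. T \<in> \<T> \<Longrightarrow> smooth_with_grad (F T) (G T)"
    "\<And>T x. T \<in> \<T> \<Longrightarrow> x \<in> interior T \<Longrightarrow> f x = F T x"
    using pieces by metis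
  have der: "(f has_derivative (\<lambda>h. G T x \<bullet> h)) (at x)" if "T \<in> \<T>" "x \<in> interior T" for T x
    using has_derivative_transform_within_open[of "F T" _ x UNIV "interior T" f] FG that
    by (auto simp: smooth_with_grad_def)
  have cl: "open (- \<Union>\<T>)" using finite_mesh cell by (auto intro!: closed_Union open_Compl)
  have der0: "(f has_derivative (\<lambda>h. 0 \<bullet> h)) (at x)" if "x \<notin> \<Union>\<T>" for x
    using has_derivative_transform_within_open[of "\<lambda>_. 0" "\<lambda>_. 0" x UNIV "- \<Union>\<T>" f] cl that zero
    by auto
  have dU: "f differentiable (at x)" if "x \<in> U" for x
    using that by (rule U_cases) (use der der0 differentiable_def in blast)+
  have cont: "continuous_on U (grad f)"
  proof (rule continuous_at_imp_continuous_on, rule ballI)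
    fix x assume "x \<in> U"
    then show "continuous (at x) (grad f)"
    proof (rule U_cases)
      fix T assume T: "T \<in> \<T>" "x \<in> interior T"
      have "continuous_on (interior T) (G T)"
        using FG(1)[OF T(1)] by (auto simp: smooth_with_grad_def intro: continuous_on_subset)
      then have "continuous_on (interior T) (grad f)"
        using grad_eq[OF der[OF T(1)]] by (simp cong: continuous_on_cong)
      then show ?thesis using T continuous_on_eq_continuous_at open_interior by blast
    next
      assume x: "x \<notin> \<Union>\<T>"
      have "continuous_on (- \<Union>\<T>) (grad f)"
        using grad_eq[OF der0] by (intro continuous_on_cong[THEN iffD2, OF refl _ continuous_on_const[of _ 0]]) auto
      then show ?thesis using x cl continuous_on_eq_continuous_at by blast
    qed
  qed
  \<comment> \<open>Boundedness comes from the closed cells: \<open>H T\<close> is continuous on the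
    compact \<open>T\<close>, and there are finitely many cells.\<close>
  have bdd: "bounded (g ` U)"
    if g: "\<And>T x. T \<in> \<T> \<Longrightarrow> x \<in> interior T \<Longrightarrow> g x = H T x"
      and H: "\<And>T. T \<in> \<T> \<Longrightarrow> continuous_on T (H T)" and g0: "\<And>x. x \<notin> \<Union>\<T> \<Longrightarrow> g x = 0"
    for g :: "real^'n \<Rightarrow> 'b::real_normed_vector" and H
  proof (rule bounded_subset)
    show "g ` U \<subseteq> (\<Union>T\<in>\<T>. H T ` T) \<union> {0}"
    proof (rule image_subsetI)
      fix x assume "x \<in> U"
      then show "g x \<in> (\<Union>T\<in>\<T>. H T ` T) \<union> {0}"
      proof (rule U_cases)
        fix T assume "T \<in> \<T>" "x \<in> interior T"
        then show ?thesis using g[of T x] interior_subset by blast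
      qed (use g0 in auto)
    qed
    show "bounded ((\<Union>T\<in>\<T>. H T ` T) \<union> {0})"
      using finite_mesh cell H by (auto intro!: bounded_UN compact_imp_bounded compact_continuous_image)
  qed
  have "bounded (f ` U)"
    using FG zero by (intro bdd[of f F]) (auto intro: smooth_with_grad_continuous[OF FG(1)])
  moreover have "bounded (grad f ` U)"
    using FG(1) grad_eq[OF der] grad_eq[OF der0]
    by (intro bdd[of "grad f" G]) (auto simp: smooth_with_grad_def intro: continuous_on_subset)
  moreover have "continuous_on U f"
    using dU by (intro continuous_at_imp_continuous_on) (auto intro: differentiable_imp_continuous_within)
  ultimately show ?thesis using cont dU by (simp add: C1_bounded_def bounded_cont_def)
qed

lemma MINI_C1_bounded:
  assumes "w \<in> MINI_functions \<T>"
  shows "C1_bounded U w"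
proof (rule piecewise_C1_bounded)
  fix T assume T: "T \<in> \<T>"
  obtain q c where q: "q \<in> P1_functions \<T>" "\<And>x. w x = q x + (\<Sum>T\<in>\<T>. c T * bubble T x)"
    using assms unfolding MINI_functions_def by blast
  obtain a b where ab: "\<And>x. x \<in> T \<Longrightarrow> q x = a \<bullet> x + b"
    using P1_functions_affine[OF q(1) T] by blast
  obtain F G where FG: "smooth_with_grad F G" "\<And>x. x \<in> T \<Longrightarrow> bubble T x = F x"
    using bubble_smooth[OF cell_simplex[OF T]] by blast
  \<comment> \<open>Only the bubble of \<open>T\<close> itself survives inside \<open>T\<close>. The
    constant \<open>c T\<close> is written as an affine function with zero slope so that the product
    rule for \<open>smooth_with_grad\<close> applies.\<close>
  have "w x = (a \<bullet> x + b) + (0 \<bullet> x + c T) * F x" if x: "x \<in> interior T" for x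
  proof -
    have xT: "x \<in> T" using x interior_subset by blast
    have "(\<Sum>T'\<in>\<T>. c T' * bubble T' x) = (\<Sum>T'\<in>\<T>. if T' = T then c T * bubble T x else 0)"
    proof (rule sum.cong[OF refl])
      fix T' assume "T' \<in> \<T>"
      then show "c T' * bubble T' x = (if T' = T then c T * bubble T x else 0)"
        using disjoint_interiors[OF T _ x, of T'] by (cases "x \<in> T'") (auto simp: bubble_def)
    qed
    then show ?thesis using q(2) ab[OF xT] FG(2)[OF xT] T finite_mesh by simp
  qed
  moreover have "smooth_with_grad (\<lambda>x. (a \<bullet> x + b) + (0 \<bullet> x + c T) * F x)
      (\<lambda>x. a + ((0 \<bullet> x + c T) *\<^sub>R G x + F x *\<^sub>R 0))"
    by (intro smooth_with_grad_add smooth_with_grad_mult smooth_with_grad_affine FG)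
  ultimately show "\<exists>F G. smooth_with_grad F G \<and> (\<forall>x \<in> interior T. w x = F x)" by blast
qed (rule MINI_zero_outside[OF assms])

end

section \<open>Finite dimension and definiteness\<close>

lemma finite_span_of_functions:
  fixes ev :: "'a::real_vector \<Rightarrow> 'x \<Rightarrow> real"
  assumes "finite J" "subspace W"
    and "\<And>u v x. ev (u + v) x = ev u x + ev v x"
    and "\<And>c v x. ev (c *\<^sub>R v) x = c * ev v x"
    and "\<And>w. w \<in> W \<Longrightarrow> (\<And>x. ev w x = 0) \<Longrightarrow> w = 0"
    and "\<And>w. w \<in> W \<Longrightarrow> \<exists>c. \<forall>x. ev w x = (\<Sum>j\<in>J. c j * \<phi> j x)"
  shows "\<exists>B. finite B \<and> span B = W"
  using assms
proof (induction J arbitrary: W rule: finite_induct)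
  case empty
  have "W \<subseteq> {0}"
  proof
    fix w assume w: "w \<in> W"
    have "w = 0" using empty.prems(5)[OF w] by (intro empty.prems(4)[OF w]) auto
    then show "w \<in> {0}" by simp
  qed
  then have "W = span {}" using subspace_0[OF empty.prems(1)] by auto
  then show ?case by (intro exI[of _ "{}"]) simp
next
  case (insert j J)
  note sub = insert.prems(1) and ev = insert.prems(2,3)
  let ?W' = "{w \<in> W. \<exists>c. \<forall>x. ev w x = (\<Sum>j\<in>J. c j * \<phi> j x)}"
  have ev0: "ev 0 x = 0" for x using ev(2)[of 0 0 x] by simp
  have "subspace ?W'"
  proof (rule subspaceI)
    show "0 \<in> ?W'"
      using subspace_0[OF sub] ev0 by (intro CollectI conjI exI[of _ "\<lambda>_. 0"]) simp_all
    fix u v assume "u \<in> ?W'" "v \<in> ?W'"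
    then obtain c d where "u \<in> W" "v \<in> W" "\<forall>x. ev u x = (\<Sum>j\<in>J. c j * \<phi> j x)"
      "\<forall>x. ev v x = (\<Sum>j\<in>J. d j * \<phi> j x)" by auto
    then show "u + v \<in> ?W'"
      using subspace_add[OF sub, of u v] ev
      by (intro CollectI conjI exI[of _ "\<lambda>j. c j + d j"]) (simp_all add: distrib_right sum.distrib)
  next
    fix t v assume "v \<in> ?W'"
    then obtain c where "v \<in> W" "\<forall>x. ev v x = (\<Sum>j\<in>J. c j * \<phi> j x)" by auto
    then show "t *\<^sub>R v \<in> ?W'"
      using subspace_scale[OF sub, of v t] ev
      by (intro CollectI conjI exI[of _ "\<lambda>j. t * c j"]) (simp_all add: sum_distrib_left mult.assoc)
  qed
  then have "\<exists>B. finite B \<and> span B = ?W'"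
  proof (rule insert.IH)
    show "w = 0" if "w \<in> ?W'" "\<And>x. ev w x = 0" for w
      using insert.prems(4)[of w] that by simp
    show "\<exists>c. \<forall>x. ev w x = (\<Sum>j\<in>J. c j * \<phi> j x)" if "w \<in> ?W'" for w
      using that by simp
  qed (rule ev)+
  then obtain B where B: "finite B" "span B = ?W'" by blast
  show ?case
  proof (cases "W = ?W'")
    case True
    then show ?thesis using B by (intro exI[of _ B]) simp
  next
    case False
    then obtain w0 where w0: "w0 \<in> W" "w0 \<notin> ?W'" by blast
    obtain c0 where c0: "\<And>x. ev w0 x = (\<Sum>j\<in>insert j J. c0 j * \<phi> j x)"
      using insert.prems(5)[OF w0(1)] by blast
    have nz: "c0 j \<noteq> 0"
    proof
      assume "c0 j = 0"
      then have "\<forall>x. ev w0 x = (\<Sum>j\<in>J. c0 j * \<phi> j x)" using c0 insert.hyps by simp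
      then show False using w0 by auto
    qed
    have "W \<subseteq> span (insert w0 B)"
    proof
      fix w assume w: "w \<in> W"
      obtain c where c: "\<And>x. ev w x = (\<Sum>j\<in>insert j J. c j * \<phi> j x)"
        using insert.prems(5)[OF w] by blast
      define t where "t = c j / c0 j"
      define w' where "w' = w - t *\<^sub>R w0"
      have "w' \<in> W" unfolding w'_def using w w0 sub by (intro subspace_diff subspace_scale)
      moreover have "ev w' x = (\<Sum>j\<in>J. (c j - t * c0 j) * \<phi> j x)" for x
      proof -
        have "ev w' x = ev w x - t * ev w0 x"
          using ev(1)[of w' "t *\<^sub>R w0" x] ev(2)[of t w0 x] by (simp add: w'_def)
        also have "\<dots> = (\<Sum>j\<in>insert j J. (c j - t * c0 j) * \<phi> j x)"
          unfolding c c0 by (simp add: left_diff_distrib sum_subtractf sum_distrib_left mult.assoc)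
        also have "\<dots> = (\<Sum>j\<in>J. (c j - t * c0 j) * \<phi> j x)"
          using insert.hyps nz by (simp add: t_def)
        finally show ?thesis .
      qed
      ultimately have "w' \<in> span B" 
        unfolding B(2) by (intro CollectI conjI exI[of _ "\<lambda>j. c j - t * c0 j"]) simp_all
      then have "w' + t *\<^sub>R w0 \<in> span (insert w0 B)"
        using span_mono[of B "insert w0 B"] by (intro span_add) (auto intro: span_scale span_base)
      then show "w \<in> span (insert w0 B)" by (simp add: w'_def)
    qed
    moreover have "span (insert w0 B) \<subseteq> W"
      using w0 B span_superset[of B] by (intro span_minimal sub) auto
    ultimately show ?thesis using B by (intro exI[of _ "insert w0 B"]) auto
  qed
qed

lemma sum_UNIV_option:
  fixes f :: "'a::finite option \<Rightarrow> 'b::comm_monoid_add"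
  shows "(\<Sum>k\<in>UNIV. f k) = f None + (\<Sum>k\<in>UNIV. f (Some k))"
  unfolding UNIV_option_conv by (subst sum.insert) (auto simp: sum.reindex)

context mesh
begin

text \<open>Cells overlap in their boundaries, so each point is assigned to a single cell; otherwise the
  local affine functions would be counted several times there.\<close>

lemma MINI_functions_spanned:
  "\<exists>(J :: ((real^'n) set \<times> 'n option option) set) \<phi>. finite J \<and>
     (\<forall>w \<in> MINI_functions \<T>. \<exists>c. \<forall>x. w x = (\<Sum>j\<in>J. c j * \<phi> j x))"
proof -
  define cell_of where "cell_of x = (SOME T. T \<in> \<T> \<and> x \<in> T)" for x
  have cell_of: "cell_of x \<in> \<T>" "x \<in> cell_of x" if "x \<in> \<Union>\<T>" for x
    using someI_ex[of "\<lambda>T. T \<in> \<T> \<and> x \<in> T"] that by (auto simp: cell_of_def)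
  \<comment> \<open>The second index encodes the shape: \<open>None\<close> is the bubble,
    \<open>Some None\<close> the constant, and \<open>Some (Some i)\<close> the \<open>i\<close>-th
    coordinate function.\<close>
  define \<phi> where "\<phi> = (\<lambda>(T, k) x. case k of None \<Rightarrow> bubble T x
    | Some k' \<Rightarrow> if x \<in> \<Union>\<T> \<and> cell_of x = T then (case k' of None \<Rightarrow> 1 | Some i \<Rightarrow> x $ i) else 0)"
  let ?J = "\<T> \<times> (UNIV :: 'n option option set)"
  have "\<exists>c. \<forall>x. w x = (\<Sum>j\<in>?J. c j * \<phi> j x)" if w: "w \<in> MINI_functions \<T>" for w
  proof -
    obtain q d where q: "q \<in> P1_functions \<T>" "\<And>x. w x = q x + (\<Sum>T\<in>\<T>. d T * bubble T x)"
      using w unfolding MINI_functions_def by blast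
    have "\<forall>T\<in>\<T>. \<exists>a b. \<forall>x \<in> T. q x = a \<bullet> x + b"
      using q(1) by (simp add: P1_functions_def)
    then obtain a b where ab: "\<And>T x. T \<in> \<T> \<Longrightarrow> x \<in> T \<Longrightarrow> q x = a T \<bullet> x + b T" by metis
    have q0: "q x = 0" if "x \<notin> \<Union>\<T>" for x
      using MINI_zero_outside[OF subsetD[OF P1_subset_MINI q(1)] that] .
    define c where "c = (\<lambda>(T, k). case k of None \<Rightarrow> d T
      | Some k' \<Rightarrow> (case k' of None \<Rightarrow> b T | Some i \<Rightarrow> a T $ i))"
    have "w x = (\<Sum>j\<in>?J. c j * \<phi> j x)" for x
    proof -
      have "(\<Sum>j\<in>?J. c j * \<phi> j x) = (\<Sum>T\<in>\<T>. \<Sum>k\<in>UNIV. c (T, k) * \<phi> (T, k) x)"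
        by (simp add: sum.cartesian_product)
      also have "\<dots> = (\<Sum>T\<in>\<T>. d T * bubble T x +
          (if x \<in> \<Union>\<T> \<and> cell_of x = T then b T + a T \<bullet> x else 0))"
        by (intro sum.cong refl)
          (simp add: sum_UNIV_option c_def \<phi>_def inner_vec_def)
      also have "\<dots> = (\<Sum>T\<in>\<T>. d T * bubble T x) + q x"
        using cell_of[of x] ab[of "cell_of x" x] q0[of x] finite_mesh
        by (cases "x \<in> \<Union>\<T>") (simp_all add: sum.distrib)
      finally show ?thesis using q(2) by simp
    qed
    then show ?thesis by (intro exI[of _ c]) simp
  qed
  then show ?thesis using finite_mesh by (intro exI[of _ ?J] exI[of _ \<phi>]) auto
qed

lemma finite_dim_scalar:
  assumes "subspace Q" "\<And>q. q \<in> Q \<Longrightarrow> apply_bcontfun q \<in> MINI_functions \<T>"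
  shows "\<exists>B. finite B \<and> span B = Q"
proof -
  obtain J :: "((real^'n) set \<times> 'n option option) set" and \<phi> where J: "finite J"
    "\<forall>w \<in> MINI_functions \<T>. \<exists>c. \<forall>x. w x = (\<Sum>j\<in>J. c j * \<phi> j x)"
    using MINI_functions_spanned by blast
  show ?thesis
  proof (rule finite_span_of_functions[where ev = apply_bcontfun and \<phi> = \<phi>, OF J(1) assms(1)])
    show "\<exists>c. \<forall>x. apply_bcontfun w x = (\<Sum>j\<in>J. c j * \<phi> j x)" if "w \<in> Q" for w
      by (rule bspec[OF J(2) assms(2)[OF that]])
  qed (auto simp: plus_bcontfun.rep_eq scaleR_bcontfun.rep_eq intro: bcontfun_eqI)
qed

lemma finite_dim_vector:
  fixes V :: "'n vfield set"
  assumes "subspace V" "\<And>v i. v \<in> V \<Longrightarrow> (\<lambda>x. apply_bcontfun v x $ i) \<in> MINI_functions \<T>"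
  shows "\<exists>B. finite B \<and> span B = V"
proof -
  obtain J :: "((real^'n) set \<times> 'n option option) set" and \<phi> where J: "finite J"
    "\<forall>w \<in> MINI_functions \<T>. \<exists>c. \<forall>x. w x = (\<Sum>j\<in>J. c j * \<phi> j x)"
    using MINI_functions_spanned by blast
  \<comment> \<open>A vector field is evaluated at pairs of a point and a component index, which
    makes it a scalar function; each scalar shape is used once per component.\<close>
  let ?ev = "\<lambda>(v :: 'n vfield) (x, i). apply_bcontfun v x $ i"
  let ?\<phi> = "\<lambda>(k :: 'n, j) (x, i). if k = i then \<phi> j x else 0"
  show ?thesis
  proof (rule finite_span_of_functions[where J = "(UNIV :: 'n set) \<times> J" and ev = ?ev and \<phi> = ?\<phi>, OF _ assms(1)])
    show "finite ((UNIV :: 'n set) \<times> J)" using J(1) by simp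
    fix v assume v: "v \<in> V"
    show "\<exists>c. \<forall>x. ?ev v x = (\<Sum>j\<in>UNIV \<times> J. c j * ?\<phi> j x)"
    proof -
      have "\<forall>i. \<exists>c. \<forall>x. apply_bcontfun v x $ i = (\<Sum>j\<in>J. c j * \<phi> j x)"
        by (intro allI bspec[OF J(2)] assms(2)[OF v])
      then obtain c where c: "\<And>i x. apply_bcontfun v x $ i = (\<Sum>j\<in>J. c i j * \<phi> j x)" by metis
      have "apply_bcontfun v x $ i = (\<Sum>j\<in>UNIV \<times> J. (case j of (k, j) \<Rightarrow> c k j) * ?\<phi> j (x, i))" for x i
      proof -
        have "(\<Sum>j\<in>UNIV \<times> J. (case j of (k, j) \<Rightarrow> c k j) * ?\<phi> j (x, i))
          = (\<Sum>k\<in>UNIV. \<Sum>j\<in>J. c k j * (if k = i then \<phi> j x else 0))"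
          unfolding sum.cartesian_product by (intro sum.cong) auto
        also have "\<dots> = (\<Sum>k\<in>UNIV. if k = i then (\<Sum>j\<in>J. c k j * \<phi> j x) else 0)"
          by (intro sum.cong) auto
        also have "\<dots> = apply_bcontfun v x $ i" using c by simp
        finally show ?thesis by simp
      qed
      then show ?thesis by (intro exI[of _ "\<lambda>(k, j). c k j"]) auto
    qed
    assume "\<And>x. ?ev v x = 0"
    then have "apply_bcontfun v x $ i = 0" for x i by (metis case_prod_conv)
    then show "v = 0" by (intro bcontfun_eqI) (simp add: vec_eq_iff)
  qed (auto simp: plus_bcontfun.rep_eq scaleR_bcontfun.rep_eq)
qed

section \<open>Rigidity of finite element fields with vanishing strain\<close>

lemma interior_subset_U:
  assumes T: "T \<in> \<T>"
  shows "interior T \<subseteq> U"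
proof
  fix x assume x: "x \<in> interior T"
  have "x \<notin> frontier T'" if T': "T' \<in> \<T>" for T'
  proof
    assume f: "x \<in> frontier T'"
    then have "x \<in> T'" using cell(3)[OF T'] frontier_subset_closed by blast
    then have "T' = T" using disjoint_interiors[OF T T' x] by simp
    then show False using f x by (simp add: frontier_def)
  qed
  then show "x \<in> U" by (simp add: U_def)
qed

text \<open>Integrals see only \<open>\<Omega>\<close>, while cells lie merely in its closure. An
  open set inside the closure of \<open>\<Omega>\<close> that misses \<open>\<Omega>\<close> is
  empty, so nothing is lost on cell interiors.\<close>

lemma zero_on_U_if_zero_on_domain:
  fixes g :: "real^'n \<Rightarrow> 'b::real_normed_vector"
  assumes cont: "continuous_on U g" and zero: "\<And>x. x \<in> \<Omega> \<Longrightarrow> x \<in> U \<Longrightarrow> g x = 0"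
    and T: "T \<in> \<T>" and x: "x \<in> interior T"
  shows "g x = 0"
proof -
  note TU = interior_subset_U[OF T]
  have op: "open (interior T \<inter> {x \<in> U. g x \<noteq> 0})"
  proof -
    have "continuous_on (interior T) g" using cont TU continuous_on_subset by blast
    then have "open (interior T \<inter> g -` (- {0}))"
      by (intro continuous_open_preimage) (auto simp: open_Compl)
    moreover have "interior T \<inter> {x \<in> U. g x \<noteq> 0} = interior T \<inter> g -` (- {0})" using TU by auto
    ultimately show ?thesis by simp
  qed
  have "interior T \<inter> {x \<in> U. g x \<noteq> 0} \<subseteq> closure \<Omega>"
    using mesh T interior_subset[of T] by (auto simp: mesh_of_def)
  moreover have "\<Omega> \<inter> (interior T \<inter> {x \<in> U. g x \<noteq> 0}) = {}" using zero by auto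
  ultimately have "interior T \<inter> {x \<in> U. g x \<noteq> 0} = {}"
    using open_Int_closure_eq_empty[OF op, of \<Omega>] by blast
  then show ?thesis using x TU by blast
qed

text \<open>A field with vanishing strain has, on every cell, constant component along \<open>e\<close> on lines
  parallel to \<open>e\<close>. On a whole line this component is therefore continuous with finitely many
  values, hence constant, and it vanishes far away.\<close>

lemma zero_strain_imp_zero:
  fixes v :: "real^'n \<Rightarrow> real^'n"
  assumes cont: "continuous_on UNIV v" and C1: "C1_field U v"
    and zero: "\<And>x. x \<notin> \<Union>\<T> \<Longrightarrow> v x = 0"
    and strain: "\<And>x. x \<in> \<Omega> \<Longrightarrow> x \<in> U \<Longrightarrow> strain v x = 0"
  shows "v = (\<lambda>_. 0)"
proof -
  note TU = interior_subset_U
  have strain0: "strain v x = 0" if "T \<in> \<T>" "x \<in> interior T" for T x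
    using zero_on_U_if_zero_on_domain[of "strain v" T x] strain that bounded_cont_strain[OF C1]
    by (simp add: bounded_cont_def)
  \<comment> \<open>The antisymmetric part of a matrix has zero quadratic form; hence the derivative
    of \<open>v\<close> in direction \<open>e\<close> has no component along
    \<open>e\<close>.\<close>
  have quad: "(grad_vec v x *v e) \<bullet> e = 0" if "T \<in> \<T>" "x \<in> interior T" for T x e
  proof -
    have "(strain v x *v e) \<bullet> e = (grad_vec v x *v e) \<bullet> e"
    proof -
      have "(transpose (grad_vec v x) *v e) \<bullet> e = (grad_vec v x *v e) \<bullet> e"
        by (metis dot_lmul_matrix inner_commute transpose_matrix_vector)
      then show ?thesis
        by (simp add: strain_def matrix_vector_mult_add_rdistrib inner_add_left
            scaleR_matrix_vector_assoc[symmetric])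
    qed
    then show ?thesis using strain0[OF that] by simp
  qed
  have int_const: "v y \<bullet> (y - x) = v x \<bullet> (y - x)"
    if T: "T \<in> \<T>" and xy: "x \<in> interior T" "y \<in> interior T" for T x y
  proof -
    let ?g = "\<lambda>t. v (x + t *\<^sub>R (y - x)) \<bullet> (y - x)"
    have mem: "x + t *\<^sub>R (y - x) \<in> interior T" if "t \<in> {0..1}" for t :: real
    proof -
      have "(1 - t) *\<^sub>R x + t *\<^sub>R y \<in> interior T"
        using convexD_alt[OF convex_interior[OF cell(1)[OF T]] xy] that by auto
      then show ?thesis by (simp add: algebra_simps)
    qed
    have "(?g has_derivative (\<lambda>_. 0)) (at t within {0..1})" if t: "t \<in> {0..1}" for t
    proof -
      let ?z = "x + t *\<^sub>R (y - x)"
      have z: "?z \<in> interior T" using mem[OF t] .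
      have "(v has_derivative (\<lambda>h. grad_vec v ?z *v h)) (at ?z)"
        using has_derivative_field[OF C1] z TU[OF T] by blast
      moreover have "((\<lambda>t. x + t *\<^sub>R (y - x)) has_derivative (\<lambda>s. s *\<^sub>R (y - x))) (at t within {0..1})"
        by (auto intro!: derivative_eq_intros)
      ultimately have "((\<lambda>t. v (x + t *\<^sub>R (y - x))) has_derivative
          (\<lambda>s. grad_vec v ?z *v (s *\<^sub>R (y - x)))) (at t within {0..1})"
        by (rule has_derivative_compose[rotated])
      then have "(?g has_derivative (\<lambda>s. (grad_vec v ?z *v (s *\<^sub>R (y - x))) \<bullet> (y - x))) (at t within {0..1})"
        by (rule has_derivative_inner_left)
      then show ?thesis
        using quad[OF T z, of "y - x"] by (simp add: matrix_vector_mult_scaleR)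
    qed
    from has_derivative_zero_constant[OF _ this]
    obtain c where "\<And>t. t \<in> {0..1} \<Longrightarrow> ?g t = c" by auto
    from this[of 0] this[of 1] show ?thesis by simp
  qed
  have cell_const: "v y \<bullet> (y - x) = v x \<bullet> (y - x)"
    if T: "T \<in> \<T>" and xy: "x \<in> T" "y \<in> T" for T x y
  proof -
    obtain z where z: "z \<in> interior T" using cell(4)[OF T] by blast
    \<comment> \<open>Both points are shrunk towards an interior point by the same factor, so their
      difference keeps its direction; the limit of zero shrinkage uses continuity of
      \<open>v\<close> across cell boundaries.\<close>
    let ?p = "\<lambda>w s. w - s *\<^sub>R (w - z)"
    have "v (?p y s) \<bullet> (y - x) = v (?p x s) \<bullet> (y - x)" if s: "0 < s" "s < 1" for s :: real
    proof -
      have "?p x s \<in> interior T" "?p y s \<in> interior T"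
        using mem_interior_convex_shrink[OF cell(1)[OF T] z] xy s by auto
      from int_const[OF T this]
      have "v (?p y s) \<bullet> ((1 - s) *\<^sub>R (y - x)) = v (?p x s) \<bullet> ((1 - s) *\<^sub>R (y - x))"
        by (simp add: algebra_simps)
      then show ?thesis using s by simp
    qed
    then have ev: "\<forall>\<^sub>F s in at_right 0. v (?p y s) \<bullet> (y - x) = v (?p x s) \<bullet> (y - x)"
      unfolding eventually_at_right_field by (intro exI[of _ 1]) auto
    have lim: "((\<lambda>s. v (?p w s) \<bullet> (y - x)) \<longlongrightarrow> v w \<bullet> (y - x)) (at_right 0)" for w
    proof -
      have "continuous_on UNIV (\<lambda>s. v (?p w s) \<bullet> (y - x))"
        by (intro continuous_intros continuous_on_compose2[OF cont]) auto
      then have "isCont (\<lambda>s. v (?p w s) \<bullet> (y - x)) 0"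
        by (simp add: continuous_on_eq_continuous_at)
      then show ?thesis
        using continuous_within[of 0 "{0<..}" "\<lambda>s. v (?p w s) \<bullet> (y - x)"] continuous_at_imp_continuous_at_within
        by fastforce
    qed
    have "((\<lambda>s. v (?p y s) \<bullet> (y - x)) \<longlongrightarrow> v x \<bullet> (y - x)) (at_right 0)"
      by (rule Lim_transform_eventually[OF lim[of x]]) (use ev in \<open>auto elim: eventually_mono\<close>)
    then show ?thesis by (rule tendsto_unique[OF trivial_limit_at_right_real lim[of y]])
  qed
  have "v x \<bullet> e = 0" for x e
  proof (cases "e = 0")
    case False
    let ?g = "\<lambda>t. v (x + t *\<^sub>R e) \<bullet> e"
    have const: "?g s = ?g t" if T: "T \<in> \<T>" "x + s *\<^sub>R e \<in> T" "x + t *\<^sub>R e \<in> T" for T s t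
    proof (cases "s = t")
      case False
      have "v (x + s *\<^sub>R e) \<bullet> ((s - t) *\<^sub>R e) = v (x + t *\<^sub>R e) \<bullet> ((s - t) *\<^sub>R e)"
        using cell_const[OF T(1,3,2)] by (simp add: algebra_simps)
      then show ?thesis using False by simp
    qed simp
    have "range ?g \<subseteq> insert 0 (\<Union>T\<in>\<T>. ?g ` {t. x + t *\<^sub>R e \<in> T})"
    proof (rule image_subsetI)
      fix t
      show "?g t \<in> insert 0 (\<Union>T\<in>\<T>. ?g ` {t. x + t *\<^sub>R e \<in> T})"
        using zero[of "x + t *\<^sub>R e"] by (cases "x + t *\<^sub>R e \<in> \<Union>\<T>") auto
    qed
    moreover have "finite (?g ` {t. x + t *\<^sub>R e \<in> T})" if T: "T \<in> \<T>" for T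
    proof (cases "{t. x + t *\<^sub>R e \<in> T} = {}")
      case False
      then obtain s where "x + s *\<^sub>R e \<in> T" by auto
      then have "?g ` {t. x + t *\<^sub>R e \<in> T} \<subseteq> {?g s}"
      proof (intro image_subsetI)
        fix t assume "t \<in> {t. x + t *\<^sub>R e \<in> T}"
        then have "?g t = ?g s" using \<open>x + s *\<^sub>R e \<in> T\<close> by (intro const[OF T]) auto
        then show "?g t \<in> {?g s}" by simp
      qed
      then show ?thesis by (rule finite_subset) simp
    qed simp
    ultimately have fin: "finite (range ?g)"
      using finite_mesh by (meson finite_UN_I finite_insert finite_subset)
    have "continuous_on UNIV ?g"
      by (intro continuous_intros continuous_on_compose2[OF cont]) auto
    then have "?g constant_on UNIV"
      by (rule continuous_finite_range_constant[OF connected_UNIV _ fin])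
    then obtain c where c: "\<And>t. ?g t = c" unfolding constant_on_def by blast
    have "bounded (\<Union>\<T>)"
      using finite_mesh by (intro bounded_Union) (auto intro: compact_imp_bounded cell(2))
    then obtain R where R: "\<And>y. y \<in> \<Union>\<T> \<Longrightarrow> norm y \<le> R" unfolding bounded_iff by blast
    define t where "t = (\<bar>R\<bar> + norm x + 1) / norm e"
    have "norm (t *\<^sub>R e) = \<bar>R\<bar> + norm x + 1"
      using False by (simp add: t_def abs_of_nonneg)
    moreover have "norm (t *\<^sub>R e) \<le> norm (x + t *\<^sub>R e) + norm x"
      using norm_triangle_ineq4[of "x + t *\<^sub>R e" x] by simp
    ultimately have "x + t *\<^sub>R e \<notin> \<Union>\<T>" using R[of "x + t *\<^sub>R e"] by force
    then have "c = 0" using c[of t] zero by simp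
    then show ?thesis using c[of 0] by simp
  qed simp
  then show ?thesis by (metis inner_eq_zero_iff)
qed

end

section \<open>The discrete Biot system\<close>

lemma psd_form_operatorI:
  assumes "subspace V"
    and "\<And>u v w. u \<in> V \<Longrightarrow> v \<in> V \<Longrightarrow> w \<in> V \<Longrightarrow> b (u + v) w = b u w + b v w"
    and "\<And>c u v. u \<in> V \<Longrightarrow> v \<in> V \<Longrightarrow> b (c *\<^sub>R u) v = c * b u v"
    and "\<And>u v. u \<in> V \<Longrightarrow> v \<in> V \<Longrightarrow> b u v = b v u"
    and "\<And>u. u \<in> V \<Longrightarrow> 0 \<le> b u u"
  shows "psd_form V (form_operator V b)"
proof
  fix u assume u: "u \<in> V"
  have "b u (v + w) = b u v + b u w" if "v \<in> V" "w \<in> V" for v w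
    using assms(2)[of v w u] assms(4)[of u "v + w"] assms(4)[of u v] assms(4)[of u w] u that
      subspace_add[OF assms(1)] by simp
  moreover have "b u (c *\<^sub>R v) = c * b u v" if "v \<in> V" for v c
    using assms(3)[of v u c] assms(4)[of u "c *\<^sub>R v"] assms(4)[of u v] u that
      subspace_scale[OF assms(1)] by simp
  ultimately show "form_operator V b u \<in> dual_space V"
    using assms(1) by (simp add: dual_space_def form_operator_def subspace_add subspace_scale)
qed (use assms in \<open>auto simp: form_operator_def\<close>)

text \<open>The trace is the Frobenius product with the identity matrix, whose squared norm is the
  dimension; then Cauchy-Schwarz.\<close>

lemma trace_sq_le:
  fixes A :: "real^'n^'n"
  shows "trace A * trace A \<le> real CARD('n) * (A \<bullet> A)"
proof -
  have "trace A = A \<bullet> mat 1"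
    by (simp add: trace_def inner_vec_def mat_def if_distrib cong: if_cong)
  moreover have "(mat 1 :: real^'n^'n) \<bullet> mat 1 = real CARD('n)"
    by (simp add: inner_vec_def mat_def if_distrib cong: if_cong)
  ultimately show ?thesis
    using Cauchy_Schwarz_ineq[of A "mat 1"] by (simp add: power2_eq_square mult.commute)
qed

text \<open>Taking the symmetric part is an orthogonal projection for the Frobenius product;
  concretely, the squared norm of the gradient minus its transpose is nonnegative.\<close>

lemma strain_sq_le: "strain v x \<bullet> strain v x \<le> grad_vec v x \<bullet> grad_vec v x"
proof -
  let ?G = "grad_vec v x"
  have t: "transpose ?G \<bullet> transpose ?G = ?G \<bullet> ?G"
    by (simp add: inner_vec_def transpose_def) (rule sum.swap)
  have "0 \<le> (?G - transpose ?G) \<bullet> (?G - transpose ?G)" by simp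
  then show ?thesis
    using t by (simp add: strain_def inner_add_left inner_add_right inner_diff_left inner_diff_right
        inner_commute)
qed

locale biot_discretization = mesh \<Omega> \<T> for \<Omega> :: "(real^'n) set" and \<T> +
  fixes V :: "'n vfield set" and Q :: "'n sfield set"
    and lam \<mu> \<alpha> K \<tau> h \<delta> \<gamma> \<xi> \<zeta> \<eta> :: real
  assumes subspace_V: "subspace V" and subspace_Q: "subspace Q"
    and V_MINI: "v \<in> V \<Longrightarrow> (\<lambda>x. apply_bcontfun v x $ i) \<in> MINI_functions \<T>"
    and Q_MINI: "q \<in> Q \<Longrightarrow> apply_bcontfun q \<in> MINI_functions \<T>"
    and params: "0 \<le> lam" "0 < \<mu>" "0 < \<alpha>" "0 < K" "0 < \<tau>" "0 < h" "0 < \<delta>" "0 < \<gamma>" "0 \<le> \<xi>"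
    and zeta: "\<zeta> = sqrt (lam + 2 * \<mu> / real CARD('n))"
    and eta: "\<eta> = \<delta> * (\<alpha>\<^sup>2 / \<zeta>\<^sup>2)"
    and inf_sup_cond: "weak_inf_sup \<Omega> h V Q \<gamma> \<xi>"
begin

lemma V_C1: "v \<in> V \<Longrightarrow> C1_field U (apply_bcontfun v)"
  unfolding C1_field_def using MINI_C1_bounded[OF V_MINI] by blast

lemma Q_C1: "q \<in> Q \<Longrightarrow> C1_bounded U (apply_bcontfun q)"
  using MINI_C1_bounded[OF Q_MINI] .

lemma zeta_pos: "0 < \<zeta>" and zeta_sq: "\<zeta>\<^sup>2 = lam + 2 * \<mu> / real CARD('n)"
proof -
  have "0 < lam + 2 * \<mu> / real CARD('n)"
    using params by (intro add_nonneg_pos divide_pos_pos) auto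
  then show "0 < \<zeta>" "\<zeta>\<^sup>2 = lam + 2 * \<mu> / real CARD('n)" by (auto simp: zeta)
qed

lemma eta_pos: "0 < \<eta>"
  using params zeta_pos by (simp add: eta)

abbreviation "a \<equiv> op_A \<Omega> V lam \<mu>"

abbreviation "c p q \<equiv> \<tau> * op_Ap \<Omega> Q K p q + \<eta> * h\<^sup>2 * op_Lp \<Omega> Q p q"

abbreviation "s p q \<equiv> c p q + \<alpha>\<^sup>2 / \<zeta>\<^sup>2 * op_M \<Omega> Q p q"

abbreviation "b p v \<equiv> \<alpha> * op_BT \<Omega> V Q p v"

abbreviation "mass p \<equiv> L2_inner \<Omega> (apply_bcontfun p) (apply_bcontfun p)"

abbreviation "grad_sq p \<equiv> L2_inner \<Omega> (grad (apply_bcontfun p)) (grad (apply_bcontfun p))"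

abbreviation "div_sq v \<equiv> L2_inner \<Omega> (divergence (apply_bcontfun v)) (divergence (apply_bcontfun v))"

lemmas V_bounded_cont = bounded_cont_strain[OF V_C1] bounded_cont_divergence[OF V_C1]
  C1_field_bounded_cont[OF V_C1]

lemma Q_bounded_cont:
  assumes "q \<in> Q"
  shows "bounded_cont U (apply_bcontfun q)" "bounded_cont U (grad (apply_bcontfun q))"
  using Q_C1[OF assms] by (auto simp: C1_bounded_def)

lemma grad_Q_add:
  "p \<in> Q \<Longrightarrow> q \<in> Q \<Longrightarrow> x \<in> U \<Longrightarrow>
    grad (apply_bcontfun (p + q)) x = grad (apply_bcontfun p) x + grad (apply_bcontfun q) x"
  using Q_C1[of p] Q_C1[of q] by (simp add: C1_bounded_def plus_bcontfun.rep_eq grad_add)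

lemma grad_Q_scale:
  "p \<in> Q \<Longrightarrow> x \<in> U \<Longrightarrow> grad (apply_bcontfun (t *\<^sub>R p)) x = t *\<^sub>R grad (apply_bcontfun p) x"
  using Q_C1[of p] by (simp add: C1_bounded_def scaleR_bcontfun.rep_eq grad_scale)

lemma a_eq: "u \<in> V \<Longrightarrow> a u u = 2 * \<mu> * L2_inner \<Omega> (strain (apply_bcontfun u)) (strain (apply_bcontfun u))
    + lam * div_sq u"
  by (simp add: op_A_def form_operator_def form_a_def)

lemma psd_a: "psd_form V a"
  unfolding op_A_def
proof (rule psd_form_operatorI[OF subspace_V])
  fix u v w assume uvw: "u \<in> V" "v \<in> V" "w \<in> V"
  have "L2_inner \<Omega> (strain (apply_bcontfun (u + v))) (strain (apply_bcontfun w)) =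
      L2_inner \<Omega> (strain (apply_bcontfun u)) (strain (apply_bcontfun w))
      + L2_inner \<Omega> (strain (apply_bcontfun v)) (strain (apply_bcontfun w))"
    by (rule L2_inner_add)
      (use uvw in \<open>simp_all add: V_bounded_cont plus_bcontfun.rep_eq strain_add[OF V_C1 V_C1]\<close>)
  moreover have "L2_inner \<Omega> (divergence (apply_bcontfun (u + v))) (divergence (apply_bcontfun w)) =
      L2_inner \<Omega> (divergence (apply_bcontfun u)) (divergence (apply_bcontfun w))
      + L2_inner \<Omega> (divergence (apply_bcontfun v)) (divergence (apply_bcontfun w))"
    by (rule L2_inner_add)
      (use uvw in \<open>simp_all add: V_bounded_cont plus_bcontfun.rep_eq divergence_add[OF V_C1 V_C1]\<close>)
  ultimately show "form_a \<Omega> lam \<mu> (apply_bcontfun (u + v)) (apply_bcontfun w) =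
      form_a \<Omega> lam \<mu> (apply_bcontfun u) (apply_bcontfun w) + form_a \<Omega> lam \<mu> (apply_bcontfun v) (apply_bcontfun w)"
    by (simp add: form_a_def algebra_simps)
next
  fix t u v assume uv: "u \<in> V" "v \<in> V"
  have "L2_inner \<Omega> (strain (apply_bcontfun (t *\<^sub>R u))) (strain (apply_bcontfun v)) =
      t * L2_inner \<Omega> (strain (apply_bcontfun u)) (strain (apply_bcontfun v))"
    by (rule L2_inner_scale)
      (use uv in \<open>simp_all add: V_bounded_cont scaleR_bcontfun.rep_eq strain_scale[OF V_C1]\<close>)
  moreover have "L2_inner \<Omega> (divergence (apply_bcontfun (t *\<^sub>R u))) (divergence (apply_bcontfun v)) =
      t * L2_inner \<Omega> (divergence (apply_bcontfun u)) (divergence (apply_bcontfun v))"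
    by (rule L2_inner_scale)
      (use uv in \<open>simp_all add: V_bounded_cont scaleR_bcontfun.rep_eq divergence_scale[OF V_C1]\<close>)
  ultimately show "form_a \<Omega> lam \<mu> (apply_bcontfun (t *\<^sub>R u)) (apply_bcontfun v) =
      t * form_a \<Omega> lam \<mu> (apply_bcontfun u) (apply_bcontfun v)"
    by (simp add: form_a_def algebra_simps)
next
  fix u v
  show "form_a \<Omega> lam \<mu> (apply_bcontfun u) (apply_bcontfun v) = form_a \<Omega> lam \<mu> (apply_bcontfun v) (apply_bcontfun u)"
    by (simp add: form_a_def L2_inner_commute)
  show "0 \<le> form_a \<Omega> lam \<mu> (apply_bcontfun u) (apply_bcontfun u)"
    unfolding form_a_def using params by (intro add_nonneg_nonneg mult_nonneg_nonneg L2_inner_nonneg) auto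
qed

lemma spd_a: "spd_form V a"
proof -
  interpret psd_form V a by (rule psd_a)
  show ?thesis
  proof
    fix u assume u: "u \<in> V" and "a u u = 0"
    then have "L2_inner \<Omega> (strain (apply_bcontfun u)) (strain (apply_bcontfun u)) = 0"
      using params L2_inner_nonneg[of "strain (apply_bcontfun u)"]
        mult_nonneg_nonneg[OF params(1) L2_inner_nonneg[of "divergence (apply_bcontfun u)"]]
        mult_nonneg_nonneg[of \<mu>, OF _ L2_inner_nonneg[of "strain (apply_bcontfun u)"]]
      unfolding a_eq[OF u] by (simp add: add_nonneg_eq_0_iff)
    then have "strain (apply_bcontfun u) x = 0" if "x \<in> \<Omega>" "x \<in> U" for x
      using L2_inner_eq_0D[OF V_bounded_cont(1)[OF u]] that by blast
    moreover have "apply_bcontfun u x = 0" if "x \<notin> \<Union>\<T>" for x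
      using MINI_zero_outside[OF V_MINI[OF u] that] by (simp add: vec_eq_iff)
    ultimately have "apply_bcontfun u = (\<lambda>_. 0)"
      using zero_strain_imp_zero[OF _ V_C1[OF u]] by auto
    then show "u = 0" by (intro bcontfun_eqI) simp
  qed (rule finite_dim_vector[OF subspace_V V_MINI])
qed

text \<open>Since \<open>K\<close> is a scalar constant, the conductivity and stabilization terms
  are multiples of the same Dirichlet form and are merged into one.\<close>

definition form_c :: "'n sfield \<Rightarrow> 'n sfield \<Rightarrow> real" where
  "form_c p q = (\<tau> * K + \<eta> * h\<^sup>2) * L2_inner \<Omega> (grad (apply_bcontfun p)) (grad (apply_bcontfun q))"

definition form_s :: "'n sfield \<Rightarrow> 'n sfield \<Rightarrow> real" where
  "form_s p q = form_c p q + \<alpha>\<^sup>2 / \<zeta>\<^sup>2 * L2_inner \<Omega> (apply_bcontfun p) (apply_bcontfun q)"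

lemma form_ap_eq: "form_ap \<Omega> K p q = K * L2_inner \<Omega> (grad p) (grad q)"
  by (simp add: form_ap_def L2_inner_def)

lemma c_eq: "c = form_operator Q form_c"
proof (intro ext)
  fix p q show "c p q = form_operator Q form_c p q"
    unfolding op_Ap_def op_Lp_def form_operator_def form_ap_eq form_c_def
    by (cases "q \<in> Q") (simp_all add: algebra_simps)
qed

lemma s_eq: "s = form_operator Q form_s"
proof (intro ext)
  fix p q show "s p q = form_operator Q form_s p q"
    unfolding fun_cong[OF fun_cong[OF c_eq], of p q] op_M_def form_operator_def form_s_def
    by (cases "q \<in> Q") simp_all
qed

lemma c_factor_pos: "0 < \<tau> * K + \<eta> * h\<^sup>2"
  using params eta_pos by (intro add_pos_nonneg) auto

lemma form_c_linear:
  assumes "p \<in> Q" "q \<in> Q" "r \<in> Q"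
  shows "form_c (p + q) r = form_c p r + form_c q r" "form_c (t *\<^sub>R p) r = t * form_c p r"
proof -
  have "L2_inner \<Omega> (grad (apply_bcontfun (p + q))) (grad (apply_bcontfun r)) =
      L2_inner \<Omega> (grad (apply_bcontfun p)) (grad (apply_bcontfun r))
      + L2_inner \<Omega> (grad (apply_bcontfun q)) (grad (apply_bcontfun r))"
    by (rule L2_inner_add) (use assms grad_Q_add[OF assms(1,2)] in \<open>simp_all add: Q_bounded_cont\<close>)
  then show "form_c (p + q) r = form_c p r + form_c q r" by (simp add: form_c_def algebra_simps)
  have "L2_inner \<Omega> (grad (apply_bcontfun (t *\<^sub>R p))) (grad (apply_bcontfun r)) =
      t * L2_inner \<Omega> (grad (apply_bcontfun p)) (grad (apply_bcontfun r))"
    by (rule L2_inner_scale) (use assms grad_Q_scale[OF assms(1)] in \<open>simp_all add: Q_bounded_cont\<close>)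
  then show "form_c (t *\<^sub>R p) r = t * form_c p r" by (simp add: form_c_def algebra_simps)
qed

lemma form_s_linear:
  assumes "p \<in> Q" "q \<in> Q" "r \<in> Q"
  shows "form_s (p + q) r = form_s p r + form_s q r" "form_s (t *\<^sub>R p) r = t * form_s p r"
proof -
  have "L2_inner \<Omega> (apply_bcontfun (p + q)) (apply_bcontfun r) =
      L2_inner \<Omega> (apply_bcontfun p) (apply_bcontfun r) + L2_inner \<Omega> (apply_bcontfun q) (apply_bcontfun r)"
    by (rule L2_inner_add) (use assms in \<open>simp_all add: Q_bounded_cont plus_bcontfun.rep_eq\<close>)
  then show "form_s (p + q) r = form_s p r + form_s q r"
    using form_c_linear(1)[OF assms] by (simp add: form_s_def algebra_simps add_divide_distrib)
  have "L2_inner \<Omega> (apply_bcontfun (t *\<^sub>R p)) (apply_bcontfun r) =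
      t * L2_inner \<Omega> (apply_bcontfun p) (apply_bcontfun r)"
    by (rule L2_inner_scale) (use assms in \<open>simp_all add: Q_bounded_cont scaleR_bcontfun.rep_eq\<close>)
  then show "form_s (t *\<^sub>R p) r = t * form_s p r"
    using form_c_linear(2)[OF assms] by (simp add: form_s_def algebra_simps)
qed

lemma form_c_nonneg: "0 \<le> form_c p p"
  unfolding form_c_def using c_factor_pos by (intro mult_nonneg_nonneg L2_inner_nonneg) auto

lemma mass_nonneg: "0 \<le> \<alpha>\<^sup>2 / \<zeta>\<^sup>2 * mass p"
  by (intro mult_nonneg_nonneg L2_inner_nonneg) auto

lemma psd_c: "psd_form Q c"
  unfolding c_eq
proof (rule psd_form_operatorI[OF subspace_Q])
  show "form_c u v = form_c v u" for u v by (simp add: form_c_def L2_inner_commute)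
qed (rule form_c_nonneg form_c_linear; assumption)+

lemma psd_s: "psd_form Q s"
  unfolding s_eq
proof (rule psd_form_operatorI[OF subspace_Q])
  show "0 \<le> form_s u u" for u
    unfolding form_s_def using form_c_nonneg mass_nonneg by (rule add_nonneg_nonneg)
  show "form_s u v = form_s v u" for u v
    by (simp add: form_s_def form_c_def L2_inner_commute)
qed (rule form_s_linear; assumption)+

text \<open>The weighted mass term alone gives definiteness: \<open>p\<close> vanishes on the cell
  interiors, then on the cells by continuity, and it is zero off the mesh by construction.\<close>

lemma spd_s: "spd_form Q s"
proof -
  interpret psd_form Q s by (rule psd_s)
  show ?thesis
  proof
    fix p assume p: "p \<in> Q" and s0: "s p p = 0"
    have "\<alpha>\<^sup>2 / \<zeta>\<^sup>2 * mass p \<le> form_s p p"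
      using form_c_nonneg[of p] by (simp add: form_s_def)
    also have "\<dots> = s p p"
      using fun_cong[OF fun_cong[OF s_eq], of p p] p by (simp add: form_operator_def)
    also note s0
    finally have "mass p \<le> 0"
      using params zeta_pos by (simp add: mult_le_0_iff divide_le_0_iff)
    then have m0: "mass p = 0" using L2_inner_nonneg[of "apply_bcontfun p"] by simp
    have U0: "apply_bcontfun p x = 0" if "x \<in> interior T" "T \<in> \<T>" for x T
      using zero_on_U_if_zero_on_domain[of "apply_bcontfun p" T x] that
        L2_inner_eq_0D[OF Q_bounded_cont(1)[OF p] m0] Q_bounded_cont(1)[OF p]
      by (auto simp: bounded_cont_def)
    have "apply_bcontfun p x = 0" for x
    proof (cases "x \<in> \<Union>\<T>")
      case True
      then obtain T where T: "T \<in> \<T>" "x \<in> T" by blast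
      have "x \<in> closure (interior T)"
        using convex_closure_interior[OF cell(1,4)[OF T(1)]] closure_subset T by blast
      then show ?thesis
        using continuous_constant_on_closure[of "interior T" "apply_bcontfun p" 0 x] U0[OF _ T(1)]
        by (meson continuous_on_apply_bcontfun)
    qed (rule MINI_zero_outside[OF Q_MINI[OF p]])
    then show "p = 0" by (intro bcontfun_eqI) simp
  qed (rule finite_dim_scalar[OF subspace_Q Q_MINI])
qed

section \<open>The coupling form and its parameter-robust estimates\<close>

lemma BT_eq:
  "p \<in> Q \<Longrightarrow> v \<in> V \<Longrightarrow> b p v = - \<alpha> * L2_inner \<Omega> (divergence (apply_bcontfun v)) (apply_bcontfun p)"
  by (simp add: op_BT_def op_B_def form_operator_def)

lemma b_dual:
  assumes "p \<in> Q"
  shows "(\<lambda>v. b p v) \<in> dual_space V"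
proof -
  have "L2_inner \<Omega> (divergence (apply_bcontfun (u + v))) (apply_bcontfun p) =
      L2_inner \<Omega> (divergence (apply_bcontfun u)) (apply_bcontfun p)
      + L2_inner \<Omega> (divergence (apply_bcontfun v)) (apply_bcontfun p)" if "u \<in> V" "v \<in> V" for u v
    by (rule L2_inner_add)
      (use assms that in \<open>simp_all add: V_bounded_cont Q_bounded_cont plus_bcontfun.rep_eq divergence_add[OF V_C1 V_C1]\<close>)
  moreover have "L2_inner \<Omega> (divergence (apply_bcontfun (t *\<^sub>R u))) (apply_bcontfun p) =
      t * L2_inner \<Omega> (divergence (apply_bcontfun u)) (apply_bcontfun p)" if "u \<in> V" for u t
    by (rule L2_inner_scale)
      (use assms that in \<open>simp_all add: V_bounded_cont Q_bounded_cont scaleR_bcontfun.rep_eq divergence_scale[OF V_C1]\<close>)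
  ultimately show ?thesis
    using assms subspace_V
    by (auto simp: dual_space_def op_BT_def op_B_def form_operator_def subspace_add subspace_scale algebra_simps)
qed

lemma b_dual':
  assumes "v \<in> V"
  shows "(\<lambda>p. b p v) \<in> dual_space Q"
proof -
  note L2_inner_commute[of "divergence (apply_bcontfun v)"]
  moreover have "L2_inner \<Omega> (apply_bcontfun (p + q)) (divergence (apply_bcontfun v)) =
      L2_inner \<Omega> (apply_bcontfun p) (divergence (apply_bcontfun v))
      + L2_inner \<Omega> (apply_bcontfun q) (divergence (apply_bcontfun v))" if "p \<in> Q" "q \<in> Q" for p q
    by (rule L2_inner_add)
      (use assms that in \<open>simp_all add: V_bounded_cont Q_bounded_cont plus_bcontfun.rep_eq\<close>)
  moreover have "L2_inner \<Omega> (apply_bcontfun (t *\<^sub>R p)) (divergence (apply_bcontfun v)) =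
      t * L2_inner \<Omega> (apply_bcontfun p) (divergence (apply_bcontfun v))" if "p \<in> Q" for p t
    by (rule L2_inner_scale)
      (use assms that in \<open>simp_all add: V_bounded_cont Q_bounded_cont scaleR_bcontfun.rep_eq\<close>)
  ultimately show ?thesis
    using assms subspace_Q
    by (auto simp: dual_space_def op_BT_def op_B_def form_operator_def subspace_add subspace_scale algebra_simps)
qed

text \<open>The divergence is the trace of the strain, so the strain term contributes
  \<open>2 * \<mu> / d\<close> and the divergence term \<open>lam\<close>; their sum is the square
  of \<open>\<zeta>\<close>.\<close>

lemma zeta_div_le:
  assumes "v \<in> V"
  shows "\<zeta>\<^sup>2 * div_sq v \<le> a v v"
proof -
  have "div_sq v \<le> real CARD('n) * L2_inner \<Omega> (strain (apply_bcontfun v)) (strain (apply_bcontfun v))"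
    by (rule L2_inner_le)
      (use assms trace_sq_le in \<open>simp_all add: V_bounded_cont divergence_eq_trace_strain\<close>)
  then have "2 * \<mu> / real CARD('n) * div_sq v
      \<le> 2 * \<mu> / real CARD('n) * (real CARD('n) * L2_inner \<Omega> (strain (apply_bcontfun v)) (strain (apply_bcontfun v)))"
    using params by (intro mult_left_mono) auto
  then show ?thesis by (simp add: a_eq[OF assms] zeta_sq distrib_right)
qed

text \<open>The squared gradient norm enters with weight \<open>2 * \<mu> + d * lam\<close>, which
  is \<open>d\<close> times the square of \<open>\<zeta>\<close>. The same weight as in
  \<open>zeta_div_le\<close> appears, up to the dimension, and this is what keeps the constants
  robust.\<close>

lemma a_le_H1:
  assumes "v \<in> V"
  shows "sqrt (a v v) \<le> sqrt (real CARD('n)) * \<zeta> * H1_norm \<Omega> (apply_bcontfun v)"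
proof -
  let ?G = "L2_inner \<Omega> (grad_vec (apply_bcontfun v)) (grad_vec (apply_bcontfun v))"
  have "L2_inner \<Omega> (strain (apply_bcontfun v)) (strain (apply_bcontfun v)) \<le> 1 * ?G"
    by (rule L2_inner_le) (use assms strain_sq_le in \<open>simp_all add: V_bounded_cont\<close>)
  then have "2 * \<mu> * L2_inner \<Omega> (strain (apply_bcontfun v)) (strain (apply_bcontfun v)) \<le> 2 * \<mu> * ?G"
    using params by (intro mult_left_mono) auto
  moreover have "div_sq v \<le> real CARD('n) * ?G"
    by (rule L2_inner_le) (use assms trace_sq_le in \<open>simp_all add: V_bounded_cont divergence_def\<close>)
  then have "lam * div_sq v \<le> lam * (real CARD('n) * ?G)"
    using params by (intro mult_left_mono)
  ultimately have "a v v \<le> 2 * \<mu> * ?G + lam * (real CARD('n) * ?G)"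
    unfolding a_eq[OF assms] by linarith
  also have "\<dots> = real CARD('n) * \<zeta>\<^sup>2 * ?G" by (simp add: zeta_sq field_simps)
  also have "\<dots> \<le> real CARD('n) * \<zeta>\<^sup>2 * (H1_norm \<Omega> (apply_bcontfun v))\<^sup>2"
    by (intro mult_left_mono) (auto simp: H1_norm_def L2_norm_sq L2_inner_nonneg)
  finally have "sqrt (a v v) \<le> sqrt (real CARD('n) * \<zeta>\<^sup>2 * (H1_norm \<Omega> (apply_bcontfun v))\<^sup>2)"
    by (rule real_sqrt_le_mono)
  also have "\<dots> = sqrt (real CARD('n)) * \<zeta> * H1_norm \<Omega> (apply_bcontfun v)"
    using zeta_pos by (simp add: real_sqrt_mult H1_norm_def)
  finally show ?thesis .
qed

lemma s_eq_c_mass: "p \<in> Q \<Longrightarrow> s p p = c p p + \<alpha>\<^sup>2 / \<zeta>\<^sup>2 * mass p"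
  by (simp add: op_M_def form_operator_def)

lemma mass_le_s: "p \<in> Q \<Longrightarrow> \<alpha>\<^sup>2 / \<zeta>\<^sup>2 * mass p \<le> s p p"
  using s_eq_c_mass[of p] psd_form.nonneg[OF psd_c, of p] by linarith

lemma c_le_s: "p \<in> Q \<Longrightarrow> c p p \<le> s p p"
  using s_eq_c_mass[of p] mass_nonneg[of p] by linarith

text \<open>Only the stabilization part is kept, because its weight matches the defect of the
  inf-sup condition; \<open>\<tau> * K\<close> has no positive lower bound.\<close>

lemma grad_le_c:
  assumes "p \<in> Q"
  shows "\<eta> * h\<^sup>2 * grad_sq p \<le> c p p"
proof -
  have "0 \<le> \<tau> * K * grad_sq p" using params by (intro mult_nonneg_nonneg L2_inner_nonneg) auto
  moreover have "c p p = \<tau> * K * grad_sq p + \<eta> * h\<^sup>2 * grad_sq p"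
    using assms by (simp add: op_Ap_def op_Lp_def form_operator_def form_ap_eq)
  ultimately show ?thesis by linarith
qed

text \<open>After Cauchy-Schwarz the square of \<open>\<alpha>\<close> is distributed as
  \<open>\<zeta>^2\<close> on the divergence and \<open>\<alpha>^2 / \<zeta>^2\<close> on the mass
  term, exactly the weights present in \<open>a\<close> and \<open>s\<close>.\<close>

lemma b_bound:
  assumes "p \<in> Q" "v \<in> V"
  shows "(b p v)\<^sup>2 \<le> a v v * s p p"
proof -
  have "(b p v)\<^sup>2 = \<alpha>\<^sup>2 * (L2_inner \<Omega> (divergence (apply_bcontfun v)) (apply_bcontfun p))\<^sup>2"
    using assms by (simp add: BT_eq power_mult_distrib)
  also have "\<dots> \<le> \<alpha>\<^sup>2 * (div_sq v * mass p)"
    using assms by (intro mult_left_mono L2_cauchy_schwarz V_bounded_cont Q_bounded_cont) auto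
  also have "\<dots> = (\<zeta>\<^sup>2 * div_sq v) * (\<alpha>\<^sup>2 / \<zeta>\<^sup>2 * mass p)" using zeta_pos by simp
  also have "\<dots> \<le> a v v * s p p"
    using zeta_div_le[OF assms(2)] mass_le_s[OF assms(1)] mass_nonneg[of p] psd_form.nonneg[OF psd_a assms(2)]
    by (intro mult_mono)
  finally show ?thesis .
qed

text \<open>Because \<open>a r\<close> equals the coupling functional, \<open>sqrt (a r r)\<close>
  bounds it in the energy norm, and \<open>a_le_H1\<close> converts this into a bound for the
  supremum over \<open>H1_norm\<close>. Squaring and weighting the inf-sup inequality then yields
  the mass term.\<close>

lemma inf_sup_estimate:
  assumes p: "p \<in> Q" and r: "r \<in> V" and b: "(\<lambda>v. b p v) = a r"
  shows "s p p \<le> 2 * real CARD('n) / \<gamma>\<^sup>2 * a r r + (1 + 2 * \<xi>\<^sup>2 / (\<delta> * \<gamma>\<^sup>2)) * c p p"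
proof -
  interpret A: spd_form V a by (rule spd_a)
  let ?C = "sqrt (real CARD('n)) * \<zeta> * sqrt (a r r) / \<alpha>"
  have C: "0 \<le> ?C" using zeta_pos params A.nonneg[OF r] by simp
  have "L2_inner \<Omega> (divergence (apply_bcontfun v)) (apply_bcontfun p) / H1_norm \<Omega> (apply_bcontfun v) \<le> ?C"
    if v: "v \<in> V" for v
  \<comment> \<open>A vanishing norm makes the quotient 0 by convention, and \<open>?C\<close> is
    nonnegative.\<close>
  proof (cases "H1_norm \<Omega> (apply_bcontfun v) = 0")
    case False
    then have H: "0 < H1_norm \<Omega> (apply_bcontfun v)"
      by (metis H1_norm_def add_nonneg_nonneg order_less_le real_sqrt_ge_zero zero_le_power2)
    have "\<alpha> * L2_inner \<Omega> (divergence (apply_bcontfun v)) (apply_bcontfun p) = - a r v"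
      using BT_eq[OF p v] fun_cong[OF b, of v] by simp
    also have "\<dots> \<le> sqrt (a r r) * sqrt (a v v)"
      using A.cauchy_schwarz[OF r v] by simp
    also have "\<dots> \<le> sqrt (a r r) * (sqrt (real CARD('n)) * \<zeta> * H1_norm \<Omega> (apply_bcontfun v))"
      using a_le_H1[OF v] A.nonneg[OF r] by (intro mult_left_mono) auto
    finally show ?thesis using H params by (simp add: field_simps)
  qed (use C in simp)
  then have "(SUP v \<in> V - {0}. ereal (L2_inner \<Omega> (divergence (apply_bcontfun v)) p
      / H1_norm \<Omega> (apply_bcontfun v))) \<le> ereal ?C"
    by (intro SUP_least) auto
  moreover have "ereal (\<gamma> * L2_norm \<Omega> p - \<xi> * h * L2_norm \<Omega> (grad p))
      \<le> (SUP v \<in> V - {0}. ereal (L2_inner \<Omega> (divergence (apply_bcontfun v)) p / H1_norm \<Omega> (apply_bcontfun v)))"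
    using inf_sup_cond p unfolding weak_inf_sup_def by blast
  ultimately have "ereal (\<gamma> * L2_norm \<Omega> p - \<xi> * h * L2_norm \<Omega> (grad p)) \<le> ereal ?C"
    by (rule order.trans[rotated])
  then have le: "\<gamma> * L2_norm \<Omega> p \<le> ?C + \<xi> * h * L2_norm \<Omega> (grad p)" by simp
  have "\<gamma>\<^sup>2 * mass p = (\<gamma> * L2_norm \<Omega> p)\<^sup>2" by (simp add: power_mult_distrib L2_norm_sq)
  also have "\<dots> \<le> (?C + \<xi> * h * L2_norm \<Omega> (grad p))\<^sup>2"
    using le params L2_inner_nonneg[of "apply_bcontfun p"] by (intro power_mono) (auto simp: L2_norm_def)
  also have "\<dots> \<le> 2 * ?C\<^sup>2 + 2 * (\<xi> * h * L2_norm \<Omega> (grad p))\<^sup>2"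
    using zero_le_power2[of "?C - \<xi> * h * L2_norm \<Omega> (grad p)"] by (simp add: power2_sum power2_diff)
  also have "\<dots> = 2 * real CARD('n) * (\<zeta>\<^sup>2 / \<alpha>\<^sup>2) * a r r + 2 * \<xi>\<^sup>2 * (h\<^sup>2 * grad_sq p)"
    using A.nonneg[OF r] by (simp add: power_mult_distrib power_divide L2_norm_sq)
  finally have "\<alpha>\<^sup>2 / \<zeta>\<^sup>2 * (\<gamma>\<^sup>2 * mass p)
      \<le> \<alpha>\<^sup>2 / \<zeta>\<^sup>2 * (2 * real CARD('n) * (\<zeta>\<^sup>2 / \<alpha>\<^sup>2) * a r r + 2 * \<xi>\<^sup>2 * (h\<^sup>2 * grad_sq p))"
    by (intro mult_left_mono) auto
  \<comment> \<open>By the choice of \<open>\<eta>\<close>, the weight in front of the gradient term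
    is \<open>\<eta> / \<delta>\<close>; the physical parameters now occur only inside the
    forms.\<close>
  also have "\<dots> = 2 * real CARD('n) * a r r + 2 * \<xi>\<^sup>2 / \<delta> * (\<eta> * h\<^sup>2 * grad_sq p)"
    using zeta_pos params by (simp add: eta field_simps)
  also have "\<dots> \<le> 2 * real CARD('n) * a r r + 2 * \<xi>\<^sup>2 / \<delta> * c p p"
    using grad_le_c[OF p] params by (intro add_left_mono mult_left_mono) auto
  finally have "\<alpha>\<^sup>2 / \<zeta>\<^sup>2 * mass p \<le> (2 * real CARD('n) * a r r + 2 * \<xi>\<^sup>2 / \<delta> * c p p) / \<gamma>\<^sup>2"
    using params by (simp add: pos_le_divide_eq mult_ac)
  moreover note s_eq_c_mass[OF p]
  ultimately show ?thesis
    using params zeta_pos by (simp add: add_divide_distrib distrib_right)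
qed

end

section \<open>Transfer of the abstract bounds to the discrete Biot operator\<close>

context biot_discretization
begin

context
  fixes Hu Hp c1 c2 \<rho>
  assumes Hu: "spd_operator V Hu" and Hp: "spd_operator Q Hp"
    and rho: "0 \<le> \<rho>" "\<rho> < 1" and c12: "0 < c1" "0 < c2"
    and spectral: "\<forall>g \<in> dual_space Q.
      c1 * g (Hp g) \<le> g (inv_into Q (\<lambda>p q. s p q) g) \<and> g (inv_into Q (\<lambda>p q. s p q) g) \<le> c2 * g (Hp g)"
    and contraction: "energy_onorm V a (\<lambda>v. v - Hu (a v)) \<le> ereal \<rho>"
begin

lemma preconditioned_biot_forms:
  "biot_forms V a Hu Q s Hp c b \<rho> (2 * real CARD('n) / \<gamma>\<^sup>2) (1 + 2 * \<xi>\<^sup>2 / (\<delta> * \<gamma>\<^sup>2)) c1 c2"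
proof -
  interpret U: preconditioned_form V a Hu
    by (intro preconditioned_form.intro spd_a preconditioned_form_axioms.intro Hu)
  interpret P: preconditioned_form Q s Hp
    by (intro preconditioned_form.intro spd_s preconditioned_form_axioms.intro Hp)
  interpret C: psd_form Q c by (rule psd_c)
  show ?thesis
  proof unfold_locales
    fix v assume v: "v \<in> V"
    show "(\<lambda>q. b q v) \<in> dual_space Q" by (rule b_dual'[OF v])
    show "a (v - U.T v) (v - U.T v) \<le> \<rho>\<^sup>2 * a v v"
    \<comment> \<open>At zero the quotient in \<open>energy_onorm\<close> is \<open>0 / 0\<close>
      and carries no information.\<close>
    proof (cases "v = 0")
      case True
      then show ?thesis using U.T_scale[of 0 0] U.zero_left by simp
    next
      case False
      then have pos: "0 < a v v" using U.definite[OF v] U.nonneg[OF v] by fastforce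
      have "ereal (energy_norm a (v - Hu (a v)) / energy_norm a v) \<le> ereal \<rho>"
        using contraction SUP_upper[OF v] unfolding energy_onorm_def by (meson order.trans)
      then have "sqrt (a (v - U.T v) (v - U.T v)) \<le> \<rho> * sqrt (a v v)"
        using pos by (simp add: energy_norm_def U.T_def pos_divide_le_eq)
      then have "(sqrt (a (v - U.T v) (v - U.T v)))\<^sup>2 \<le> (\<rho> * sqrt (a v v))\<^sup>2"
        using U.nonneg[of "v - U.T v"] v by (intro power_mono) auto
      then show ?thesis
        using U.nonneg[of "v - U.T v"] v pos by (simp add: power_mult_distrib)
    qed
    fix p assume p: "p \<in> Q"
    show "(b p v)\<^sup>2 \<le> a v v * s p p" by (rule b_bound[OF p v])
    show "b p = a v \<Longrightarrow> s p p \<le> 2 * real CARD('n) / \<gamma>\<^sup>2 * a v v + (1 + 2 * \<xi>\<^sup>2 / (\<delta> * \<gamma>\<^sup>2)) * c p p"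
      by (rule inf_sup_estimate[OF p v])
  next
    fix p assume p: "p \<in> Q"
    show "b p \<in> dual_space V" by (rule b_dual[OF p])
    show "c1 * P.k p p \<le> s p p" "s p p \<le> c2 * P.k p p"
      by (rule P.spectral_bounds[OF spectral p])+
    show "c p p \<le> s p p" by (rule c_le_s[OF p])
  qed (use rho c12 params in auto)
qed

theorem preconditioned_bounds:
  assumes x': "x' \<in> dual_space V \<times> dual_space Q" "x' \<noteq> (\<lambda>_. 0, \<lambda>_. 0)"
  defines "y \<equiv> biot_operator \<Omega> V Q lam \<mu> \<alpha> K \<tau> h \<eta> (precond_U \<Omega> V Q \<alpha> Hu Hp x')"
  shows "1 / fov_const \<rho> (2 * real CARD('n) / \<gamma>\<^sup>2) (1 + 2 * \<xi>\<^sup>2 / (\<delta> * \<gamma>\<^sup>2)) c2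
      \<le> inner_wrt (precond_D Hu Hp) y x' / inner_wrt (precond_D Hu Hp) x' x'"
    and "norm_wrt (precond_D Hu Hp) y / norm_wrt (precond_D Hu Hp) x' \<le> sqrt (norm_const c1)"
proof -
  have A: "biot_operator \<Omega> V Q lam \<mu> \<alpha> K \<tau> h \<eta> (u, p) = (\<lambda>v. a u v + b p v, \<lambda>q. - b q u + c p q)"
    if "u \<in> V" "p \<in> Q" for u p
  proof -
    have "op_B \<Omega> Q u q = op_BT \<Omega> V Q q u" for q
      using that by (simp add: op_BT_def form_operator_def)
    then show ?thesis by (simp add: biot_operator_def)
  qed
  note F = biot_forms.field_of_values_bounds[OF preconditioned_biot_forms A x']
  show "1 / fov_const \<rho> (2 * real CARD('n) / \<gamma>\<^sup>2) (1 + 2 * \<xi>\<^sup>2 / (\<delta> * \<gamma>\<^sup>2)) c2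
      \<le> inner_wrt (precond_D Hu Hp) y x' / inner_wrt (precond_D Hu Hp) x' x'"
    using F(1) unfolding y_def precond_U_def .
  show "norm_wrt (precond_D Hu Hp) y / norm_wrt (precond_D Hu Hp) x' \<le> sqrt (norm_const c1)"
    using F(2) unfolding y_def precond_U_def .
qed

end

end

theorem theorem7:
  fixes \<gamma> \<xi> \<delta> \<rho> c1u c2u c1p c2p :: real
  assumes dim: "CARD('n::finite) \<in> {2, 3}"
    and "0 < \<gamma>" and "0 \<le> \<xi>" and "0 < \<delta>" and "0 \<le> \<rho>" and "\<rho> < 1"
    and "0 < c1u" and "0 < c2u" and "0 < c1p" and "0 < c2p"
  shows "\<exists>Sig > 0. \<exists>Ups > 0.
    \<forall>(\<Omega> :: (real^'n) set) \<T> V Q lam \<mu> \<alpha> K \<tau> h \<eta> \<zeta> Hu Hp.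
      open \<Omega> \<longrightarrow> bounded \<Omega> \<longrightarrow> lipschitz_boundary \<Omega> \<longrightarrow>
      0 \<le> lam \<longrightarrow> 0 < \<mu> \<longrightarrow> 0 < \<alpha> \<longrightarrow> 0 < K \<longrightarrow> 0 < \<tau> \<longrightarrow> 0 < h \<longrightarrow>
      mesh_of \<Omega> \<T> \<longrightarrow> mesh_size \<T> = h \<longrightarrow>
      (V = P1_vector \<T> \<and> Q = P1_scalar \<T>) \<or>
        (V = MINI_vector \<T> \<and> Q = P1_scalar \<T> \<and> \<xi> = 0) \<longrightarrow>
      weak_inf_sup \<Omega> h V Q \<gamma> \<xi> \<longrightarrow>
      \<zeta> = sqrt (lam + 2 * \<mu> / real CARD('n)) \<longrightarrow>
      \<eta> = \<delta> * (\<alpha>\<^sup>2 / \<zeta>\<^sup>2) \<longrightarrow>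
      spd_operator V Hu \<longrightarrow> spd_operator Q Hp \<longrightarrow>
      (\<forall>f \<in> dual_space V.
         c1u * f (Hu f) \<le> f (inv_into V (op_A \<Omega> V lam \<mu>) f) \<and>
         f (inv_into V (op_A \<Omega> V lam \<mu>) f) \<le> c2u * f (Hu f)) \<longrightarrow>
      (let S = (\<lambda>p q. \<tau> * op_Ap \<Omega> Q K p q + \<eta> * h\<^sup>2 * op_Lp \<Omega> Q p q
                        + \<alpha>\<^sup>2 / \<zeta>\<^sup>2 * op_M \<Omega> Q p q)
       in \<forall>g \<in> dual_space Q.
         c1p * g (Hp g) \<le> g (inv_into Q S g) \<and> g (inv_into Q S g) \<le> c2p * g (Hp g)) \<longrightarrow>
      energy_onorm V (op_A \<Omega> V lam \<mu>) (\<lambda>v. v - Hu (op_A \<Omega> V lam \<mu> v)) \<le> ereal \<rho> \<longrightarrow>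
      (let \<A> = biot_operator \<Omega> V Q lam \<mu> \<alpha> K \<tau> h \<eta>;
           MU = precond_U \<Omega> V Q \<alpha> Hu Hp;
           MD = precond_D Hu Hp
       in \<forall>x' \<in> dual_space V \<times> dual_space Q. x' \<noteq> (\<lambda>_. 0, \<lambda>_. 0) \<longrightarrow>
            Sig \<le> inner_wrt MD (\<A> (MU x')) x' / inner_wrt MD x' x' \<and>
            norm_wrt MD (\<A> (MU x')) / norm_wrt MD x' \<le> Ups)"
proof -
  \<comment> \<open>The witnesses are formed before the domain, the mesh and the physical parameters
    are introduced, which is what makes them uniform.\<close>
  let ?k1 = "2 * real CARD('n) / \<gamma>\<^sup>2" and ?k2 = "1 + 2 * \<xi>\<^sup>2 / (\<delta> * \<gamma>\<^sup>2)"
  let ?Sig = "1 / fov_const \<rho> ?k1 ?k2 c2p" and ?Ups = "sqrt (norm_const c1p)"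
  have Sig: "0 < ?Sig"
    using assms by (intro divide_pos_pos fov_const_pos add_nonneg_nonneg divide_nonneg_nonneg) auto
  have Ups: "0 < ?Ups" using norm_const_pos[of c1p] assms by simp
  show ?thesis
    unfolding Let_def
  proof (rule exI[of _ ?Sig], rule conjI[OF Sig], rule exI[of _ ?Ups], rule conjI[OF Ups],
      intro allI impI ballI conjI)
    fix \<Omega> :: "(real^'n) set" and \<T> V Q lam \<mu> \<alpha> K \<tau> h \<eta> \<zeta> Hu Hp
      and x' :: "('n vfield \<Rightarrow> real) \<times> ('n sfield \<Rightarrow> real)"
    assume dom: "open \<Omega>" "bounded \<Omega>" and params: "0 \<le> lam" "0 < \<mu>" "0 < \<alpha>" "0 < K" "0 < \<tau>" "0 < h"
      and mesh: "mesh_of \<Omega> \<T>"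
      and spaces: "(V = P1_vector \<T> \<and> Q = P1_scalar \<T>) \<or>
        (V = MINI_vector \<T> \<and> Q = P1_scalar \<T> \<and> \<xi> = 0)"
      and infsup: "weak_inf_sup \<Omega> h V Q \<gamma> \<xi>"
      and zeta: "\<zeta> = sqrt (lam + 2 * \<mu> / real CARD('n))"
      and eta: "\<eta> = \<delta> * (\<alpha>\<^sup>2 / \<zeta>\<^sup>2)"
      and H: "spd_operator V Hu" "spd_operator Q Hp"
      and spectral: "\<forall>g\<in>dual_space Q.
          c1p * g (Hp g) \<le> g (inv_into Q (\<lambda>p q. \<tau> * op_Ap \<Omega> Q K p q + \<eta> * h\<^sup>2 * op_Lp \<Omega> Q p q
                        + \<alpha>\<^sup>2 / \<zeta>\<^sup>2 * op_M \<Omega> Q p q) g) \<and>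
          g (inv_into Q (\<lambda>p q. \<tau> * op_Ap \<Omega> Q K p q + \<eta> * h\<^sup>2 * op_Lp \<Omega> Q p q
                        + \<alpha>\<^sup>2 / \<zeta>\<^sup>2 * op_M \<Omega> Q p q) g) \<le> c2p * g (Hp g)"
      and contr: "energy_onorm V (op_A \<Omega> V lam \<mu>) (\<lambda>v. v - Hu (op_A \<Omega> V lam \<mu> v)) \<le> ereal \<rho>"
      and x': "x' \<in> dual_space V \<times> dual_space Q" "x' \<noteq> (\<lambda>_. 0, \<lambda>_. 0)"
    have "P1_vector \<T> \<subseteq> MINI_vector \<T>"
      using P1_subset_MINI[of \<T>] unfolding P1_vector_def MINI_vector_def by fast
    then have "V \<subseteq> MINI_vector \<T>" using spaces by blast
    then have V: "subspace V" "\<And>v i. v \<in> V \<Longrightarrow> (\<lambda>x. apply_bcontfun v x $ i) \<in> MINI_functions \<T>"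
      using spaces subspace_P1_vector subspace_MINI_vector unfolding MINI_vector_def by blast+
    have Q: "subspace Q" "\<And>q. q \<in> Q \<Longrightarrow> apply_bcontfun q \<in> MINI_functions \<T>"
      using spaces subspace_P1_scalar P1_subset_MINI[of \<T>] unfolding P1_scalar_def by blast+
    interpret D: biot_discretization \<Omega> \<T> V Q lam \<mu> \<alpha> K \<tau> h \<delta> \<gamma> \<xi> \<zeta> \<eta>
      by unfold_locales (fact dom mesh V Q params assms zeta eta infsup)+
    note bounds = D.preconditioned_bounds[OF H \<open>0 \<le> \<rho>\<close> \<open>\<rho> < 1\<close> \<open>0 < c1p\<close> \<open>0 < c2p\<close> spectral contr x']
    show "?Sig \<le> inner_wrt (precond_D Hu Hp)
        (biot_operator \<Omega> V Q lam \<mu> \<alpha> K \<tau> h \<eta> (precond_U \<Omega> V Q \<alpha> Hu Hp x')) x' /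
        inner_wrt (precond_D Hu Hp) x' x'"
      by (rule bounds(1))
    show "norm_wrt (precond_D Hu Hp)
        (biot_operator \<Omega> V Q lam \<mu> \<alpha> K \<tau> h \<eta> (precond_U \<Omega> V Q \<alpha> Hu Hp x')) /
        norm_wrt (precond_D Hu Hp) x' \<le> ?Ups"
      by (rule bounds(2))
  qed
qed

end
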